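(* Let $p$ be an odd prime, let $G$ be a finite $p$-group and let $A\leq G$ be an abelian subgroup. Suppose that $B\leq G$ is a subgroup of nilpotency class at most $2$ such that $B'\leq A$, $A\leq N_G(B)$ and $B\nleq N_G(A)$. Then there exists an abelian subgroup $A^*$ of $G$ such that (a) $|A|=|A^*|$; (b) $A\cap B< A^*\cap B$ (proper containment); (c) $A^*\leq N_G(A)\cap A^G$; (d) the exponent of $A^*$ divides the exponent of $A$, and moreover $\mathrm{rank}(A)\leq \mathrm{rank}(A^* )$.
   Context: All groups are finite. $B'=[B,B]$ is the commutator subgroup of $B$. $A^G$ denotes the normal closure of $A$ in $G$, i.e. the subgroup generated by all conjugates $A^g=g^{-1}Ag$, $g\in G$. The rank of an abelian $p$-group is its minimal number of generators. *)

theory Defs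
  imports "HOL-Algebra.Algebra" "HOL-Computational_Algebra.Primes"
begin

text \<open>
  Subgroups are carrier sets inside an ambient group \<open>G\<close>. The commutator convention is the one of
  the library's \<^const>\<open>derived\<close>, so that \<open>commutator_subgroup G H H\<close> is \<open>derived G H\<close>;
  on subgroups, the convention \<open>[h, k] = h\<^sup>-\<^sup>1 k\<^sup>-\<^sup>1 h k\<close> gives the same generating set.
\<close>

definition commutator_subgroup ::
  "('a, 'b) monoid_scheme \<Rightarrow> 'a set \<Rightarrow> 'a set \<Rightarrow> 'a set" where
  "commutator_subgroup G H K =
     generate G (\<Union>h \<in> H. \<Union>k \<in> K. {h \<otimes>\<^bsub>G\<^esub> k \<otimes>\<^bsub>G\<^esub> inv\<^bsub>G\<^esub> h \<otimes>\<^bsub>G\<^esub> inv\<^bsub>G\<^esub> k})"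

lemma derived_eq_commutator_subgroup: "derived G H = commutator_subgroup G H H"
  by (simp add: derived_def commutator_subgroup_def)

text \<open>Indexed from 0: the \<open>n\<close>-th entry is the term usually written \<open>\<gamma>\<^bsub>n+1\<^esub>(H)\<close>.\<close>

primrec lower_central_series ::
  "('a, 'b) monoid_scheme \<Rightarrow> 'a set \<Rightarrow> nat \<Rightarrow> 'a set" where
  "lower_central_series G H 0 = H"
| "lower_central_series G H (Suc n) = commutator_subgroup G (lower_central_series G H n) H"

definition nilpotent_of_class_at_most ::
  "('a, 'b) monoid_scheme \<Rightarrow> 'a set \<Rightarrow> nat \<Rightarrow> bool" where
  "nilpotent_of_class_at_most G H c \<longleftrightarrow> lower_central_series G H c = {\<one>\<^bsub>G\<^esub>}"

definition normal_closure :: "('a, 'b) monoid_scheme \<Rightarrow> 'a set \<Rightarrow> 'a set" where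
  "normal_closure G A =
     generate G (\<Union>g \<in> carrier G. \<Union>a \<in> A. {inv\<^bsub>G\<^esub> g \<otimes>\<^bsub>G\<^esub> a \<otimes>\<^bsub>G\<^esub> g})"

text \<open>The next two notions are meant for finite \<open>H\<close>; otherwise the \<open>LEAST\<close> may be over an empty set.\<close>

definition subgroup_exponent :: "('a, 'b) monoid_scheme \<Rightarrow> 'a set \<Rightarrow> nat" where
  "subgroup_exponent G H = (LEAST n::nat. 0 < n \<and> (\<forall>x \<in> H. x [^]\<^bsub>G\<^esub> n = \<one>\<^bsub>G\<^esub>))"

definition subgroup_rank :: "('a, 'b) monoid_scheme \<Rightarrow> 'a set \<Rightarrow> nat" where
  "subgroup_rank G H = (LEAST n. \<exists>S. S \<subseteq> H \<and> finite S \<and> card S = n \<and> generate G S = H)"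

definition finite_p_group :: "nat \<Rightarrow> ('a, 'b) monoid_scheme \<Rightarrow> bool" where
  "finite_p_group p G \<longleftrightarrow> group G \<and> finite (carrier G) \<and> (\<exists>n. order G = p ^ n)"

end

theory Submission
  imports Defs
begin

text \<open>
  The subgroup \<open>A B\<close> is a \<open>p\<close>-group in which \<open>A\<close> is not normal, and normalizers grow in \<open>p\<close>-groups.
  So there is \<open>b \<in> B\<close> outside the normalizer of \<open>A\<close> such that \<open>A\<close> and its conjugate \<open>\<phi> A\<close> normalize
  each other, where \<open>\<phi> x = b x b\<^bsup>-1\<^esup>\<close> (lemma \<open>exists_normalizing_element\<close>). Both being abelian, \<open>A\<close>
  and \<open>\<phi> A\<close> generate a group in which \<open>Z = A \<inter> \<phi> A\<close> is central and contains all commutators. Put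
  \<open>\<delta> a = a\<^bsup>-1\<^esup> \<phi> a\<close>. The replacement for \<open>A\<close> is \<open>C = \<delta>(A) Z\<close>. It is a subgroup because \<open>\<delta>\<close> is a
  homomorphism modulo \<open>Z\<close>, and it lies in the group generated by \<open>A\<close> and \<open>\<phi> A\<close>, hence in the normalizer
  and in the normal closure of \<open>A\<close>.

  The main point is that \<open>C\<close> is abelian (lemma \<open>\<delta>_comm\<close>). Writing \<open>x = \<phi> a\<close> and \<open>y = \<phi> c\<close>, the
  commutator of \<open>a\<^bsup>-1\<^esup> x\<close> and \<open>c\<^bsup>-1\<^esup> y\<close> is, up to inversion, the product of the commutators of \<open>a\<close> with
  \<open>y\<close> and of \<open>x\<close> with \<open>c\<close>. Conjugating twice by \<open>b\<close> gives more: as \<open>\<delta> a \<in> B\<close> and \<open>B' \<subseteq> A\<close>, the map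
  \<open>\<phi>\<close> fixes \<open>\<delta> a\<close> modulo \<open>Z\<close>, so \<open>\<phi> (\<phi> a)\<close> is \<open>x a\<^bsup>-1\<^esup> x\<close> modulo \<open>Z\<close>. These elements commute, being
  conjugates of elements of \<open>A\<close>, and that says that the square of the same product of commutators is
  trivial. Since \<open>p\<close> is odd, the product is trivial.

  For the order, \<open>A \<inter> B\<close> is invariant under \<open>\<phi>\<close> because it contains \<open>B'\<close>. It follows that \<open>Z\<close> is the set
  of \<open>k \<in> A\<close> with \<open>\<phi> k \<in> A\<close> (lemma \<open>in_Z_iff\<close>). This is the kernel of \<open>\<delta>\<close> modulo \<open>Z\<close>, so \<open>C\<close> has the
  order of \<open>A\<close> (lemma \<open>card_replacement\<close>). Moreover \<open>A \<inter> B \<subseteq> Z \<subseteq> C\<close>, and \<open>\<delta> a\<close> is in \<open>C \<inter> B\<close> but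
  not in \<open>A\<close> whenever \<open>\<phi> a \<notin> A\<close>, which happens for some \<open>a\<close> by the choice of \<open>b\<close>.

  Exponent and rank rest on one observation (lemma \<open>C_pow_eq_one\<close>): for odd \<open>e\<close>, elements \<open>a \<in> A\<close>
  and \<open>z \<in> Z\<close> with \<open>a\<^sup>e = z\<^sup>e = 1\<close> give \<open>(\<delta> a z)\<^sup>e = 1\<close>, by the power formula in class two. With \<open>e\<close> the
  exponent of \<open>A\<close> this bounds the exponent of \<open>C\<close>. With \<open>e = p\<close> the counting argument shows
  that \<open>C\<close> has at least as many solutions of \<open>x\<^sup>p = 1\<close> as \<open>A\<close>, and in an abelian \<open>p\<close>-group of rank \<open>r\<close>
  there are exactly \<open>p\<^sup>r\<close> of them (lemma \<open>prime_power_rank\<close>).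
\<close>

section \<open>Normalizers in finite groups\<close>

lemma (in group) subgroup_of_finite_if_closed:
  assumes fin: "finite (carrier G)" and sub: "H \<subseteq> carrier G" and one: "\<one> \<in> H"
    and mult: "\<And>x y. x \<in> H \<Longrightarrow> y \<in> H \<Longrightarrow> x \<otimes> y \<in> H"
  shows "subgroup H G"
proof (rule subgroupI)
  fix x assume x: "x \<in> H"
  have pow: "x [^] (n::nat) \<in> H" for n
    by (induction n) (use one mult x in auto)
  have xG: "x \<in> carrier G" using x sub by blast
  have "order G > 0" using fin by (simp add: order_gt_0_iff_finite)
  then obtain m where m: "order G = Suc m" using not0_implies_Suc by blast
  have "x [^] m \<otimes> x = \<one>" using pow_order_eq_1[OF xG] m by simp
  then have "inv x = x [^] m" using xG by (metis inv_equality nat_pow_closed)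
  then show "inv x \<in> H" using pow by simp
qed (use assms in auto)

lemma (in group) cancel_inv_left:
  assumes "x \<in> carrier G" "y \<in> carrier G"
  shows "inv x \<otimes> (x \<otimes> y) = y" "x \<otimes> (inv x \<otimes> y) = y"
  using assms by (simp_all add: m_assoc[symmetric])

lemma (in group) mem_normalizer_iff:
  assumes "H \<subseteq> carrier G"
  shows "g \<in> normalizer G H \<longleftrightarrow> g \<in> carrier G \<and> (\<lambda>h. g \<otimes> h \<otimes> inv g) ` H = H"
proof -
  have "g <# H #> inv g = (\<lambda>h. g \<otimes> h \<otimes> inv g) ` H"
    by (auto simp: l_coset_def r_coset_def)
  then show ?thesis using assms by (simp add: normalizer_def stabilizer_def)
qed

lemma (in group) conjugation_inj_on:
  assumes "H \<subseteq> carrier G" "g \<in> carrier G"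
  shows "inj_on (\<lambda>h. g \<otimes> h \<otimes> inv g) H"
  using assms by (intro inj_onI) (metis inv_closed l_cancel m_closed r_cancel subsetD)

lemma (in group) mem_normalizer_of_finite_iff:
  assumes fin: "finite H" and H: "H \<subseteq> carrier G"
  shows "g \<in> normalizer G H \<longleftrightarrow> g \<in> carrier G \<and> (\<forall>h \<in> H. g \<otimes> h \<otimes> inv g \<in> H)"
proof -
  have "(\<lambda>h. g \<otimes> h \<otimes> inv g) ` H = H" if "g \<in> carrier G" "\<forall>h \<in> H. g \<otimes> h \<otimes> inv g \<in> H"
    using that by (intro endo_inj_surj[OF fin] conjugation_inj_on[OF H]) auto
  then show ?thesis unfolding mem_normalizer_iff[OF H] by blast
qed

lemma (in group) subgroup_le_normalizer:
  assumes fin: "finite H" and H: "subgroup H G"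
  shows "H \<subseteq> normalizer G H"
  using assms subgroup.mem_carrier[OF H] subgroup.m_closed[OF H] subgroup.m_inv_closed[OF H]
  by (auto simp: mem_normalizer_of_finite_iff[OF fin subgroup.subset[OF H]])

lemma (in group) finite_carrier_if_order_prime_power:
  assumes "Factorial_Ring.prime p" "order G = p ^ n"
  shows "finite (carrier G)"
  using assms by (metis card_gt_0_iff order_def prime_gt_0_nat zero_less_power)

text \<open>
  All orbits of a \<open>p\<close>-group have \<open>p\<close>-power length, so those with more than one point have length
  divisible by \<open>p\<close>.
\<close>

lemma (in group_action) prime_dvd_card_if_no_fixed_point:
  assumes p: "Factorial_Ring.prime p" and ord: "order G = p ^ n"
    and Y: "Y \<subseteq> E" "finite Y" and inv: "\<And>g y. g \<in> carrier G \<Longrightarrow> y \<in> Y \<Longrightarrow> \<phi> g y \<in> Y"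
    and nofix: "\<And>y. y \<in> Y \<Longrightarrow> \<exists>g \<in> carrier G. \<phi> g y \<noteq> y"
  shows "p dvd card Y"
proof -
  let ?O = "orbit G \<phi> ` Y"
  have sub: "orbit G \<phi> y \<subseteq> Y" if "y \<in> Y" for y
    using inv that by (auto simp: orbit_def)
  have refl: "y \<in> orbit G \<phi> y" if "y \<in> Y" for y
    using that Y orbit_refl by blast
  have union: "\<Union>?O = Y" using sub refl by blast
  have dvd: "p dvd card C" if CO: "C \<in> ?O" for C
  proof -
    obtain y where y: "y \<in> Y" and C: "C = orbit G \<phi> y" using CO by blast
    have "card C * card (stabilizer G \<phi> y) = p ^ n"
      using orbit_stabilizer_theorem[of y] y Y ord C by auto
    then have "card C dvd p ^ n" by (metis dvd_triv_left)
    then obtain i where i: "card C = p ^ i" using p by (metis divides_primepow_nat)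
    obtain g where g: "g \<in> carrier G" "\<phi> g y \<noteq> y" using nofix y by blast
    have "{y, \<phi> g y} \<subseteq> C" using refl[OF y] g C by (auto simp: orbit_def)
    moreover have "finite C" using sub[OF y] C Y(2) finite_subset by blast
    ultimately have "card {y, \<phi> g y} \<le> card C" by (intro card_mono)
    then have "i \<noteq> 0" using g i by (intro notI) auto
    then show ?thesis using i by simp
  qed
  have disj: "C1 \<inter> C2 = {}" if "C1 \<in> ?O" "C2 \<in> ?O" "C1 \<noteq> C2" for C1 C2
  proof -
    have O: "C1 \<in> orbits G E \<phi>" "C2 \<in> orbits G E \<phi>" using that Y by (auto simp: orbits_def)
    show ?thesis
      using orbit_partition O that(3) unfolding partition_def by blast
  qed
  show ?thesis using dvd_partition[of ?O p] union Y dvd disj by metis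
qed

text \<open>
  Suppose \<open>M\<close> is its own normalizer in \<open>K\<close>, and consider its \<open>K\<close>-conjugates. The group \<open>K\<close> has no fixed
  point among them, since a conjugate fixed by \<open>K\<close> would make \<open>M\<close> normal in \<open>K\<close>. The group \<open>M\<close> fixes
  exactly one of them, namely \<open>M\<close>. So \<open>p\<close> divides both the number of conjugates and that number
  minus one.
\<close>

lemma (in group) normalizers_grow:
  assumes p: "Factorial_Ring.prime p" and ord: "order G = p ^ n"
    and M: "subgroup M G" and K: "subgroup K G" and MK: "M \<subset> K"
  shows "\<exists>x \<in> K - M. \<forall>m \<in> M. x \<otimes> m \<otimes> inv x \<in> M"
proof (rule ccontr)
  assume "\<not> ?thesis"
  then have self: "x \<in> M" if "x \<in> K" "\<And>m. m \<in> M \<Longrightarrow> x \<otimes> m \<otimes> inv x \<in> M" for x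
    using that by blast
  have fin: "finite (carrier G)" by (rule finite_carrier_if_order_prime_power[OF p ord])
  \<comment> \<open>\<open>\<phi>\<close> is the library's conjugation action on subsets; \<open>\<psi>\<close> is the same map as an image.\<close>
  define \<psi> where "\<psi> g S = (\<lambda>h. g \<otimes> h \<otimes> inv g) ` S" for g S
  define \<phi> where "\<phi> = (\<lambda>g. \<lambda>H \<in> {H. H \<subseteq> carrier G}. g <# H #> (inv g))"
  have \<phi>: "\<phi> g S = \<psi> g S" if "S \<subseteq> carrier G" for g S
    using that by (auto simp: \<phi>_def \<psi>_def l_coset_def r_coset_def)
  have MG: "M \<subseteq> carrier G" and KG: "K \<subseteq> carrier G" using M K subgroup.subset by auto
  have \<psi>_mult: "\<psi> g (\<psi> h S) = \<psi> (g \<otimes> h) S" if "g \<in> carrier G" "h \<in> carrier G" "S \<subseteq> carrier G" for g h S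
  proof -
    have "g \<otimes> (h \<otimes> s \<otimes> inv h) \<otimes> inv g = g \<otimes> h \<otimes> s \<otimes> inv (g \<otimes> h)" if "s \<in> S" for s
      using that \<open>S \<subseteq> carrier G\<close> \<open>g \<in> carrier G\<close> \<open>h \<in> carrier G\<close> by (auto simp: m_assoc inv_mult_group)
    then show ?thesis by (simp add: \<psi>_def image_image)
  qed
  have \<psi>_one: "\<psi> \<one> S = S" if "S \<subseteq> carrier G" for S
  proof -
    have "(\<lambda>h. \<one> \<otimes> h \<otimes> inv \<one>) ` S = (\<lambda>h. h) ` S" using that by (intro image_cong) auto
    then show ?thesis by (simp add: \<psi>_def)
  qed
  have fixM: "x \<in> M" if "x \<in> K" "\<psi> x M = M" for x
    using self that unfolding \<psi>_def by blast
  have MfixM: "\<psi> m M = M" if "m \<in> M" for m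
    using subsetD[OF subgroup_le_normalizer[OF finite_subset[OF MG fin] M] that]
    by (simp add: mem_normalizer_iff[OF MG] \<psi>_def)
  define Cs where "Cs = (\<lambda>g. \<psi> g M) ` K"
  have CsG: "S \<subseteq> carrier G" if "S \<in> Cs" for S
    using that MG KG by (auto simp: Cs_def \<psi>_def)
  have finCs: "finite Cs" using finite_subset[OF KG fin] by (simp add: Cs_def)
  have Csinv: "\<psi> g S \<in> Cs" if "g \<in> K" "S \<in> Cs" for g S
    using that \<psi>_mult MG KG K by (auto simp: Cs_def subset_iff intro!: imageI subgroup.m_closed)
  have MCs: "M \<in> Cs" using \<psi>_one[OF MG] subgroup.one_closed[OF K] by (force simp: Cs_def)
  have back_conj: "\<psi> (inv x \<otimes> (g \<otimes> x)) M = M" if "x \<in> carrier G" "g \<in> carrier G" "\<psi> g (\<psi> x M) = \<psi> x M" for x g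
    using that \<psi>_mult[of g x M] \<psi>_mult[of "inv x" "g \<otimes> x" M] \<psi>_mult[of "inv x" x M] \<psi>_one MG
    by simp
  have act: "group_action (G\<lparr>carrier := H\<rparr>) {H. H \<subseteq> carrier G} \<phi>" if "subgroup H G" for H
    unfolding \<phi>_def using group_action.induced_action[OF action_by_conjugation_on_power_set that] .
  have ordH: "\<exists>i. order (G\<lparr>carrier := H\<rparr>) = p ^ i" if "subgroup H G" for H
  proof -
    have "card H dvd p ^ n" using lagrange[OF that] ord by (metis dvd_triv_right)
    then show ?thesis using p by (auto simp: order_def divides_primepow_nat)
  qed
  have "p dvd card Cs"
  proof -
    obtain i where i: "order (G\<lparr>carrier := K\<rparr>) = p ^ i" using ordH[OF K] by blast
    show ?thesis
    proof (rule group_action.prime_dvd_card_if_no_fixed_point[OF act[OF K] p i _ finCs])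
      fix S assume S: "S \<in> Cs"
      then obtain x where x: "x \<in> K" "S = \<psi> x M" by (auto simp: Cs_def)
      show "\<exists>g\<in>carrier (G\<lparr>carrier := K\<rparr>). \<phi> g S \<noteq> S"
      proof (rule ccontr)
        assume "\<not> ?thesis"
        then have fix_all: "\<psi> g S = S" if "g \<in> K" for g using \<phi>[OF CsG[OF S]] that by auto
        have "g \<in> M" if g: "g \<in> K" for g
        proof -
          let ?g = "x \<otimes> g \<otimes> inv x"
          have "?g \<in> K" using g x K by (simp add: subgroup.m_closed subgroup.m_inv_closed)
          moreover have "inv x \<otimes> (?g \<otimes> x) = g" using g x KG
            by (simp add: m_assoc cancel_inv_left subset_iff)
          ultimately show ?thesis using back_conj[of x ?g] fix_all[of ?g] g x KG fixM[of g] by auto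
        qed
        then show False using MK by blast
      qed
    qed (use CsG \<phi> Csinv in auto)
  qed
  moreover have "p dvd card (Cs - {M})"
  proof -
    obtain i where i: "order (G\<lparr>carrier := M\<rparr>) = p ^ i" using ordH[OF M] by blast
    show ?thesis
    proof (rule group_action.prime_dvd_card_if_no_fixed_point[OF act[OF M] p i])
      fix S assume S: "S \<in> Cs - {M}"
      then obtain x where x: "x \<in> K" "S = \<psi> x M" by (auto simp: Cs_def)
      have xG: "x \<in> carrier G" using x KG by blast
      show "\<exists>g\<in>carrier (G\<lparr>carrier := M\<rparr>). \<phi> g S \<noteq> S"
      proof (rule ccontr)
        assume "\<not> ?thesis"
        then have fix_all: "\<psi> g S = S" if "g \<in> M" for g using \<phi> CsG S that by auto
        have "inv x \<otimes> m \<otimes> inv (inv x) \<in> M" if m: "m \<in> M" for m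
        proof -
          have mG: "m \<in> carrier G" using m MG by blast
          have "inv x \<otimes> (m \<otimes> x) \<in> K" using m MK x(1) K
            by (meson psubsetD subgroup.m_closed subgroup.m_inv_closed)
          then show ?thesis using fixM back_conj[OF xG mG] fix_all[OF m] x xG mG by (simp add: m_assoc)
        qed
        then have "inv x \<in> M" using self K x by (simp add: subgroup.m_inv_closed)
        then have "x \<in> M" using M xG subgroup.m_inv_closed by fastforce
        then show False using MfixM x S by blast
      qed
    next
      fix g S assume g: "g \<in> carrier (G\<lparr>carrier := M\<rparr>)" and S: "S \<in> Cs - {M}"
      have gM: "g \<in> M" "g \<in> carrier G" using g MG by auto
      have SG: "S \<subseteq> carrier G" using S CsG by blast
      have "\<psi> g S \<noteq> M"
      proof
        assume "\<psi> g S = M"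
        then have "\<psi> (inv g) M = S"
          using \<psi>_mult[of "inv g" g S] \<psi>_one[OF SG] SG gM by simp
        then show False using MfixM[of "inv g"] gM M S by (simp add: subgroup.m_inv_closed)
      qed
      then show "\<phi> g S \<in> Cs - {M}" using \<phi>[OF SG] Csinv[of g S] S gM MK by auto
    qed (use CsG finCs in auto)
  qed
  moreover have "card Cs = Suc (card (Cs - {M}))" using card_Suc_Diff1[OF finCs MCs] by simp
  ultimately have "p dvd 1" using dvd_diff_nat[of p "card Cs" "card (Cs - {M})"] by simp
  then show False using p not_prime_unit by blast
qed

section \<open>The rank of an abelian p-group\<close>

lemma card_eq_mult_card_image:
  assumes "finite A" and "\<And>y. y \<in> f ` A \<Longrightarrow> card {x \<in> A. f x = y} = k"
  shows "card A = k * card (f ` A)"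
proof -
  have "card A = (\<Sum>y \<in> f ` A. \<Sum>x \<in> {x \<in> A. f x = y}. 1)"
    using sum.image_gen[OF assms(1), of "\<lambda>_. 1::nat" f] by simp
  also have "\<dots> = (\<Sum>y \<in> f ` A. k)" by (intro sum.cong refl) (simp add: assms(2))
  finally show ?thesis by simp
qed

lemma (in group) prime_mult_card_le_card_supergroup:
  assumes p: "Factorial_Ring.prime p" and ord: "order G = p ^ n"
    and T: "subgroup T G" and U: "subgroup U G" and TU: "T \<subset> U"
  shows "p * card T \<le> card U"
proof -
  have U_dvd: "card U dvd p ^ n" using lagrange[OF U] ord by (metis dvd_triv_right)
  have "p ^ n > 0" using p prime_gt_0_nat by simp
  then have U0: "card U > 0" using U_dvd by (metis dvd_0_left gr0I)
  have "subgroup T (G\<lparr>carrier := U\<rparr>)" using T U TU by (simp add: subgroup_incl psubset_imp_subset)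
  moreover have "order (G\<lparr>carrier := U\<rparr>) = card U" by (simp add: order_def)
  ultimately have "card T dvd card U"
    using group.lagrange[OF subgroup_imp_group[OF U], of T] by (metis dvd_triv_right)
  then obtain k where k: "card U = k * card T" by (metis dvd_def mult.commute)
  have "card T < card U" using TU U0 by (simp add: card_gt_0_iff psubset_card_mono)
  then have k1: "k > 1" using k
    by (metis less_one linorder_neqE_nat mult_1 mult_zero_left not_less_zero order_less_irrefl)
  have "k dvd p ^ n" using k U_dvd by (metis dvd_mult_left)
  then obtain i where "k = p ^ i" using p by (metis divides_primepow_nat)
  then have "p dvd k" using k1 by (cases i) auto
  then have "p \<le> k" using k1 by (intro dvd_imp_le) auto
  then show ?thesis using k by simp
qed

lemma (in group) generate_insert_generate:
  assumes "S \<subseteq> carrier G" "x \<in> carrier G"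
  shows "generate G (insert x (generate G S)) = generate G (insert x S)"
proof
  have "generate G S \<subseteq> generate G (insert x S)" by (intro mono_generate) auto
  moreover have "x \<in> generate G (insert x S)" by (auto intro: generate.incl)
  ultimately show "generate G (insert x (generate G S)) \<subseteq> generate G (insert x S)"
    using assms by (intro generate_subgroup_incl generate_is_subgroup) auto
  show "generate G (insert x S) \<subseteq> generate G (insert x (generate G S))"
    by (intro mono_generate) (auto intro: generate.incl)
qed

lemma (in comm_group) card_generate_insert_le:
  assumes fin: "finite (carrier G)" and T: "subgroup T G" and x: "x \<in> carrier G"
    and p: "p > 0" and xp: "x [^] (p::nat) \<in> T"
  shows "card (generate G (insert x T)) \<le> p * card T"
proof -
  let ?f = "\<lambda>(t, i). t \<otimes> x [^] (i::nat)"
  let ?U = "?f ` (T \<times> UNIV)"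
  have TG: "T \<subseteq> carrier G" using T subgroup.subset by blast
  have finT: "finite T" using TG fin finite_subset by blast
  have "subgroup ?U G"
  proof (rule subgroup_of_finite_if_closed[OF fin])
    show "?U \<subseteq> carrier G" using TG x by auto
    have "\<one> = ?f (\<one>, 0)" by simp
    then show "\<one> \<in> ?U" using subgroup.one_closed[OF T] by blast
  next
    fix u v assume "u \<in> ?U" "v \<in> ?U"
    then obtain t i s j where "t \<in> T" "s \<in> T" and uv: "u = ?f (t, i)" "v = ?f (s, j)" by auto
    then have "t \<in> carrier G" "s \<in> carrier G" "t \<otimes> s \<in> T" using TG subgroup.m_closed[OF T] by auto
    then have "u \<otimes> v = ?f (t \<otimes> s, i + j)" "t \<otimes> s \<in> T" 
      using uv x by (auto simp: nat_pow_mult[symmetric] m_ac)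
    then show "u \<otimes> v \<in> ?U" by blast
  qed
  moreover have "insert x T \<subseteq> ?U"
  proof -
    have "x = ?f (\<one>, 1)" using x by simp
    then have "x \<in> ?U" using subgroup.one_closed[OF T] by blast
    moreover have "t \<in> ?U" if "t \<in> T" for t
    proof -
      have "t = ?f (t, 0)" using that TG by auto
      then show ?thesis using that by blast
    qed
    ultimately show ?thesis by blast
  qed
  ultimately have "generate G (insert x T) \<subseteq> ?U" by (rule generate_subgroup_incl[rotated])
  also have "?U \<subseteq> ?f ` (T \<times> {..<p})"
  proof
    fix u assume "u \<in> ?U"
    then obtain t i where t: "t \<in> T" and u: "u = ?f (t, i)" by auto
    have "(x [^] p) [^] (j::nat) \<in> T" for j
      by (induction j) (use xp T in \<open>auto simp: subgroup.one_closed subgroup.m_closed\<close>)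
    then have tx: "t \<otimes> (x [^] p) [^] (i div p) \<in> T"
      using subgroup.m_closed[OF T t] by blast
    have "x [^] i = (x [^] p) [^] (i div p) \<otimes> x [^] (i mod p)"
      using x by (simp add: nat_pow_pow nat_pow_mult)
    then have "u = ?f (t \<otimes> (x [^] p) [^] (i div p), i mod p)"
      using u x t TG by (auto simp: m_assoc)
    moreover have "i mod p < p" using p by simp
    ultimately show "u \<in> ?f ` (T \<times> {..<p})" using tx by blast
  qed
  finally have "card (generate G (insert x T)) \<le> card (?f ` (T \<times> {..<p}))"
    using finT by (intro card_mono) auto
  also have "\<dots> \<le> card (T \<times> {..<p})" using finT by (intro card_image_le) auto
  finally show ?thesis by (simp add: card_cartesian_product mult.commute)
qed

lemma (in comm_group) subgroup_powers: "subgroup ((\<lambda>x. x [^] (k::nat)) ` carrier G) G"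
proof (rule subgroupI)
  fix a assume "a \<in> (\<lambda>x. x [^] k) ` carrier G"
  then show "inv a \<in> (\<lambda>x. x [^] k) ` carrier G" by (auto simp: nat_pow_inv[symmetric])
next
  fix a b assume "a \<in> (\<lambda>x. x [^] k) ` carrier G" "b \<in> (\<lambda>x. x [^] k) ` carrier G"
  then show "a \<otimes> b \<in> (\<lambda>x. x [^] k) ` carrier G" by (auto simp: nat_pow_distrib[symmetric])
qed auto

lemma (in comm_group) card_generate_with_powers_le:
  assumes fin: "finite (carrier G)" and p: "p > 0" and S: "finite S" "S \<subseteq> carrier G"
  defines "P \<equiv> (\<lambda>x. x [^] (p::nat)) ` carrier G"
  shows "card (generate G (S \<union> P)) \<le> p ^ card S * card P"
  using S
proof (induction S rule: finite_induct)
  case empty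
  have "generate G P = P" unfolding P_def
    using generateI[OF subgroup_powers[of p] order_refl] by simp
  then show ?case by simp
next
  case (insert x S)
  have PG: "P \<subseteq> carrier G" by (auto simp: P_def)
  let ?T = "generate G (S \<union> P)"
  have T: "subgroup ?T G" using insert PG by (intro generate_is_subgroup) auto
  have "card (generate G (insert x S \<union> P)) = card (generate G (insert x ?T))"
    using generate_insert_generate[of "S \<union> P" x] insert PG by auto
  also have "\<dots> \<le> p * card ?T"
    using insert by (intro card_generate_insert_le fin T p) (auto simp: P_def intro: generate.incl)
  also have "\<dots> \<le> p * (p ^ card S * card P)" using insert by (intro mult_left_mono) auto
  finally show ?case using insert by simp
qed

text \<open>
  Every \<open>x\<close> has the form \<open>q r\<^sup>p\<close> with \<open>q\<close> generated by \<open>S\<close>. Applying this to \<open>r\<close> again and again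
  gives \<open>x = q r\<^bsup>p^k\<^esup>\<close> for each \<open>k\<close>, with varying \<open>q\<close> and \<open>r\<close>, and the last factor is trivial once
  \<open>p\<^sup>k\<close> is the order of the group.
\<close>

lemma (in comm_group) generate_eq_carrier_if_with_powers:
  assumes ord: "order G = p ^ n" and S: "S \<subseteq> carrier G"
    and gen: "generate G (S \<union> (\<lambda>x. x [^] (p::nat)) ` carrier G) = carrier G"
  shows "generate G S = carrier G"
proof -
  let ?Q = "generate G S"
  have Q: "subgroup ?Q G" using S by (rule generate_is_subgroup)
  have QG: "?Q \<subseteq> carrier G" using Q subgroup.subset by blast
  define W where "W = {q \<otimes> r [^] p | q r. q \<in> ?Q \<and> r \<in> carrier G}"
  have WI: "q \<otimes> r [^] p \<in> W" if "q \<in> ?Q" "r \<in> carrier G" for q r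
    using that unfolding W_def by blast
  have "subgroup W G"
  proof (rule subgroupI)
    show "W \<subseteq> carrier G" using QG by (auto simp: W_def)
    show "W \<noteq> {}" using WI[OF subgroup.one_closed[OF Q] one_closed] by blast
  next
    fix u assume "u \<in> W"
    then obtain q r where q: "q \<in> ?Q" and r: "r \<in> carrier G" and u: "u = q \<otimes> r [^] p"
      by (auto simp: W_def)
    have "inv u = inv q \<otimes> (inv r) [^] p"
      using q r u QG by (auto simp: inv_mult_group nat_pow_inv m_comm)
    then show "inv u \<in> W" using WI q r Q by (simp add: subgroup.m_inv_closed)
  next
    fix u v assume "u \<in> W" "v \<in> W"
    then obtain q r s t where "q \<in> ?Q" "s \<in> ?Q" and r: "r \<in> carrier G" "t \<in> carrier G"
      and u: "u = q \<otimes> r [^] p" "v = s \<otimes> t [^] p"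
      by (auto simp: W_def)
    moreover from this have "u \<otimes> v = (q \<otimes> s) \<otimes> (r \<otimes> t) [^] p"
      using QG by (auto simp: nat_pow_distrib m_ac subset_iff)
    ultimately show "u \<otimes> v \<in> W" using WI Q by (simp add: subgroup.m_closed)
  qed
  moreover have "S \<union> (\<lambda>x. x [^] p) ` carrier G \<subseteq> W"
  proof -
    have "s \<in> W" if "s \<in> S" for s
    proof -
      have "s = s \<otimes> \<one> [^] p" using that S by auto
      then show ?thesis using WI[of s \<one>] that by (simp add: generate.incl)
    qed
    moreover have "x [^] p \<in> W" if "x \<in> carrier G" for x
      using WI[OF subgroup.one_closed[OF Q] that] that by simp
    ultimately show ?thesis by blast
  qed
  ultimately have "carrier G \<subseteq> W" using gen generate_subgroup_incl by blast
  then have step: "\<exists>q \<in> ?Q. \<exists>r \<in> carrier G. x = q \<otimes> r [^] p" if "x \<in> carrier G" for x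
    using that unfolding W_def by blast
  have "\<exists>q \<in> ?Q. \<exists>r \<in> carrier G. x = q \<otimes> r [^] (p ^ k)" if "x \<in> carrier G" for x k
  proof (induction k)
    case 0
    have "x = \<one> \<otimes> x [^] (p ^ 0)" using that by simp
    then show ?case using that subgroup.one_closed[OF Q] by blast
  next
    case (Suc k)
    then obtain q r where q: "q \<in> ?Q" and r: "r \<in> carrier G" and x: "x = q \<otimes> r [^] (p ^ k)" by blast
    obtain s t where s: "s \<in> ?Q" and t: "t \<in> carrier G" and rs: "r = s \<otimes> t [^] p"
      using step[OF r] by blast
    have sG: "s \<in> carrier G" and qG: "q \<in> carrier G" using s q QG by auto
    have "x = (q \<otimes> s [^] (p ^ k)) \<otimes> t [^] (p ^ Suc k)"
      using x rs sG qG t by (simp add: nat_pow_distrib nat_pow_pow m_assoc)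
    moreover have "s [^] (j::nat) \<in> ?Q" for j
      by (induction j) (use s Q in \<open>auto simp: subgroup.one_closed subgroup.m_closed\<close>)
    then have "q \<otimes> s [^] (p ^ k) \<in> ?Q" using q Q by (simp add: subgroup.m_closed)
    ultimately show ?case using t by blast
  qed
  from this[of _ n] have "x \<in> ?Q" if "x \<in> carrier G" for x
    using that pow_order_eq_1 ord QG by fastforce
  then show ?thesis using QG by blast
qed

text \<open>
  The greedy choice: each new generator outside the subgroup generated so far, together with the
  \<open>p\<close>-th powers, enlarges that subgroup by a factor of at least \<open>p\<close>.
\<close>

lemma (in comm_group) exists_small_generating_set:
  assumes p: "Factorial_Ring.prime p" and ord: "order G = p ^ n"
  defines "P \<equiv> (\<lambda>x. x [^] (p::nat)) ` carrier G"
  shows "\<exists>S. S \<subseteq> carrier G \<and> finite S \<and> generate G S = carrier G \<and> p ^ card S * card P \<le> order G"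
proof -
  have fin: "finite (carrier G)" by (rule finite_carrier_if_order_prime_power[OF p ord])
  have PG: "P \<subseteq> carrier G" by (auto simp: P_def)
  define good where "good S \<longleftrightarrow> S \<subseteq> carrier G \<and> p ^ card S * card P \<le> card (generate G (S \<union> P))" for S
  have gen_sub: "subgroup (generate G (S \<union> P)) G" if "S \<subseteq> carrier G" for S
    using that PG by (intro generate_is_subgroup) auto
  have gen_le: "card (generate G (S \<union> P)) \<le> order G" if "S \<subseteq> carrier G" for S
    unfolding order_def using gen_sub[OF that] subgroup.subset fin by (intro card_mono) auto
  have "generate G P = P" unfolding P_def
    using generateI[OF subgroup_powers[of p] order_refl] by simp
  then have "good {}" by (simp add: good_def)
  moreover have "\<forall>S. good S \<longrightarrow> card (generate G (S \<union> P)) < Suc (order G)"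
    using gen_le by (auto simp: good_def less_Suc_eq_le)
  ultimately obtain S where S: "good S"
    and max: "\<And>S'. good S' \<Longrightarrow> card (generate G (S' \<union> P)) \<le> card (generate G (S \<union> P))"
    using ex_has_greatest_nat[of good "{}" "\<lambda>S. card (generate G (S \<union> P))" "Suc (order G)"] by blast
  have SG: "S \<subseteq> carrier G" and finS: "finite S" using S fin finite_subset by (auto simp: good_def)
  let ?T = "generate G (S \<union> P)"
  have TG: "?T \<subseteq> carrier G" using gen_sub[OF SG] subgroup.subset by blast
  have "?T = carrier G"
  proof (rule ccontr)
    assume "?T \<noteq> carrier G"
    then obtain x where x: "x \<in> carrier G" "x \<notin> ?T" using TG by blast
    let ?U = "generate G (insert x S \<union> P)"
    have U: "subgroup ?U G" using gen_sub[of "insert x S"] SG x by blast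
    have "?T \<subseteq> ?U" by (intro mono_generate) auto
    moreover have "x \<in> ?U" by (auto intro: generate.incl)
    ultimately have "?T \<subset> ?U" using x by blast
    then have le: "p * card ?T \<le> card ?U"
      using prime_mult_card_le_card_supergroup[OF p ord gen_sub[OF SG] U] by blast
    have "x \<notin> S" using x by (auto intro: generate.incl)
    then have "p ^ card (insert x S) * card P = p * (p ^ card S * card P)" using finS by simp
    also have "\<dots> \<le> p * card ?T" using S by (intro mult_le_mono2) (simp add: good_def)
    also note le
    finally have "p ^ card (insert x S) * card P \<le> card ?U" .
    then have "good (insert x S)" using SG x by (simp add: good_def)
    then have "card ?U \<le> card ?T" using max by blast
    moreover have "card ?T > 0" using fin TG gen_sub[OF SG] subgroup.one_closed
      by (metis card_gt_0_iff empty_iff finite_subset)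
    ultimately show False using le prime_gt_1_nat[OF p]
      by (metis le_trans mult_le_cancel2 mult_1 not_le)
  qed
  then have "generate G S = carrier G" "p ^ card S * card P \<le> order G"
    using generate_eq_carrier_if_with_powers[OF ord SG] S by (auto simp: P_def good_def order_def)
  then show ?thesis using SG finS by blast
qed

text \<open>
  Both sides are the index of the subgroup \<open>P\<close> of \<open>p\<close>-th powers: the left one because a generator
  enlarges a subgroup containing \<open>P\<close> by a factor of at most \<open>p\<close>, and greedily chosen ones by exactly
  \<open>p\<close>; the right one because it is the size of the kernel of the \<open>p\<close>-th power map. This turns the
  comparison of ranks into the comparison of the numbers of solutions of \<open>x\<^sup>p = 1\<close>.
\<close>

lemma (in comm_group) prime_power_rank:
  assumes p: "Factorial_Ring.prime p" and ord: "order G = p ^ n"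
  shows "p ^ subgroup_rank G (carrier G) = card {x \<in> carrier G. x [^] p = \<one>}"
proof -
  let ?r = "subgroup_rank G (carrier G)"
  define P where "P = (\<lambda>x. x [^] (p::nat)) ` carrier G"
  let ?gen = "\<lambda>n S. S \<subseteq> carrier G \<and> finite S \<and> card S = n \<and> generate G S = carrier G"
  have fin: "finite (carrier G)" by (rule finite_carrier_if_order_prime_power[OF p ord])
  obtain S where S: "S \<subseteq> carrier G" "finite S" "generate G S = carrier G"
    "p ^ card S * card P \<le> order G"
    using exists_small_generating_set[OF p ord] unfolding P_def by blast
  have "\<exists>R. ?gen ?r R" unfolding subgroup_rank_def
    using S by (intro LeastI_ex[of "\<lambda>n. \<exists>S. ?gen n S"]) blast
  then obtain R where R: "?gen ?r R" by blast
  have "generate G R \<subseteq> generate G (R \<union> P)" by (intro mono_generate) auto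
  moreover have "generate G (R \<union> P) \<subseteq> carrier G"
    using R by (intro generate_subgroup_incl subgroup_self) (auto simp: P_def)
  ultimately have "order G \<le> p ^ ?r * card P"
    using card_generate_with_powers_le[OF fin prime_gt_0_nat[OF p], of R] R
    by (simp add: P_def order_def)
  moreover have "?r \<le> card S" unfolding subgroup_rank_def using S by (intro Least_le) blast
  then have "p ^ ?r * card P \<le> p ^ card S * card P"
    using prime_gt_0_nat[OF p] by (intro mult_right_mono power_increasing) auto
  ultimately have 1: "p ^ ?r * card P = order G" using S(4) by linarith
  have "card {x \<in> carrier G. x [^] p = y} = card {x \<in> carrier G. x [^] p = \<one>}"
    if "y \<in> P" for y
  proof -
    obtain c where c: "c \<in> carrier G" "y = c [^] p" using \<open>y \<in> P\<close> by (auto simp: P_def)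
    have "bij_betw (\<lambda>x. c \<otimes> x) {x \<in> carrier G. x [^] p = \<one>} {x \<in> carrier G. x [^] p = y}"
      by (rule bij_betw_byWitness[where f' = "\<lambda>x. inv c \<otimes> x"])
        (use c in \<open>auto simp: cancel_inv_left nat_pow_distrib nat_pow_inv\<close>)
    then show ?thesis by (simp add: bij_betw_same_card)
  qed
  then have "order G = card {x \<in> carrier G. x [^] p = \<one>} * card P"
    unfolding order_def P_def by (intro card_eq_mult_card_image fin) auto
  moreover have "card P > 0" using fin by (auto simp: P_def card_gt_0_iff)
  ultimately show ?thesis using 1 by simp
qed

lemma (in group) subgroup_rank_restrict:
  assumes "subgroup H G"
  shows "subgroup_rank (G\<lparr>carrier := H\<rparr>) H = subgroup_rank G H"
proof -
  have "(S \<subseteq> H \<and> finite S \<and> card S = n \<and> generate (G\<lparr>carrier := H\<rparr>) S = H) \<longleftrightarrow>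
    (S \<subseteq> H \<and> finite S \<and> card S = n \<and> generate G S = H)" for S n
    using generate_consistent[OF _ assms] by auto
  then show ?thesis by (simp add: subgroup_rank_def)
qed

lemma (in group) rank_le_rank_if_card_le:
  assumes p: "Factorial_Ring.prime p" and ord: "order G = p ^ n"
    and A: "subgroup A G" "comm_group (G\<lparr>carrier := A\<rparr>)"
    and C: "subgroup C G" "comm_group (G\<lparr>carrier := C\<rparr>)"
    and le: "card {x \<in> A. x [^] p = \<one>} \<le> card {x \<in> C. x [^] p = \<one>}"
  shows "subgroup_rank G A \<le> subgroup_rank G C"
proof -
  have rank: "p ^ subgroup_rank G H = card {x \<in> H. x [^] p = \<one>}"
    if H: "subgroup H G" "comm_group (G\<lparr>carrier := H\<rparr>)" for H
  proof -
    have "card H dvd p ^ n" using lagrange[OF H(1)] ord by (metis dvd_triv_right)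
    then obtain i where "order (G\<lparr>carrier := H\<rparr>) = p ^ i"
      using p by (auto simp: order_def divides_primepow_nat)
    from comm_group.prime_power_rank[OF H(2) p this] show ?thesis
      by (simp add: subgroup_rank_restrict[OF H(1)] nat_pow_consistent[symmetric])
  qed
  show ?thesis using rank[OF A] rank[OF C] le prime_gt_1_nat[OF p]
    by (metis power_increasing_iff)
qed

section \<open>Exponents\<close>

lemma (in group) subgroup_pow_card_eq_one:
  assumes "subgroup H G" "x \<in> H"
  shows "x [^] card H = \<one>"
  using group.pow_order_eq_1[OF subgroup_imp_group[OF assms(1)], of x] assms
  by (simp add: order_def nat_pow_consistent[symmetric])

lemma (in group) subgroup_exponent:
  assumes "finite (carrier G)" "subgroup H G"
  shows subgroup_exponent_pos: "subgroup_exponent G H > 0"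
    and pow_subgroup_exponent: "x \<in> H \<Longrightarrow> x [^] subgroup_exponent G H = \<one>"
proof -
  have "0 < card H" using assms by (simp add: subgroup.finite_imp_card_positive)
  then have "\<exists>n::nat. 0 < n \<and> (\<forall>x \<in> H. x [^] n = \<one>)"
    using subgroup_pow_card_eq_one[OF assms(2)] by blast
  then have "0 < subgroup_exponent G H \<and> (\<forall>x \<in> H. x [^] subgroup_exponent G H = \<one>)"
    unfolding subgroup_exponent_def by (rule LeastI_ex)
  then show "subgroup_exponent G H > 0" "x \<in> H \<Longrightarrow> x [^] subgroup_exponent G H = \<one>" by auto
qed

lemma (in group) subgroup_exponent_dvd:
  assumes fin: "finite (carrier G)" and H: "subgroup H G" and e: "\<And>x. x \<in> H \<Longrightarrow> x [^] (e::nat) = \<one>"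
  shows "subgroup_exponent G H dvd e"
proof (rule ccontr)
  let ?s = "subgroup_exponent G H"
  assume "\<not> ?s dvd e"
  then have "0 < e mod ?s" by (simp add: mod_greater_zero_iff_not_dvd)
  moreover have "x [^] (e mod ?s) = \<one>" if "x \<in> H" for x
  proof -
    have x: "x \<in> carrier G" using subgroup.mem_carrier[OF H that] .
    have "\<one> = x [^] (?s * (e div ?s) + e mod ?s)" using e[OF that] by simp
    also have "\<dots> = (x [^] ?s) [^] (e div ?s) \<otimes> x [^] (e mod ?s)"
      using x by (simp add: nat_pow_pow nat_pow_mult)
    finally show ?thesis using pow_subgroup_exponent[OF fin H that] x by simp
  qed
  ultimately have "?s \<le> e mod ?s"
    unfolding subgroup_exponent_def by (intro Least_le) blast
  then show False using subgroup_exponent_pos[OF fin H] mod_less_divisor not_le by blast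
qed

section \<open>Commutator calculus in class two\<close>

lemma (in group) eq_one_if_square_eq_one:
  assumes "odd (order G)" "x \<in> carrier G" "x \<otimes> x = \<one>"
  shows "x = \<one>"
proof -
  have "x [^] (2::nat) = \<one>" using assms by (simp add: numeral_2_eq_2)
  then have "ord x dvd 2" using assms(2) pow_eq_id by blast
  moreover have "odd (ord x)"
    using assms(1) ord_dvd_group_order[OF assms(2)] dvd_trans by blast
  ultimately have "ord x = 1" by (metis dvd_refl even_numeral prime_nat_iff two_is_prime_nat)
  then show ?thesis using assms(2) ord_eq_1 by blast
qed

text \<open>
  Given the other relations, \<open>x p x\<close> commutes with \<open>y q y\<close> exactly if \<open>(v w)\<^sup>2 = 1\<close>, whereas \<open>p x\<close>
  commutes with \<open>q y\<close> exactly if \<open>v w = 1\<close>. In a group of odd order these are the same. The lemma is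
  applied with \<open>x\<close> and \<open>y\<close> conjugates of \<open>p\<^bsup>-1\<^esup>\<close> and \<open>q\<^bsup>-1\<^esup>\<close>.
\<close>

lemma (in group) commute_if_doubled_commute:
  assumes odd: "odd (order G)"
    and G: "p \<in> carrier G" "q \<in> carrier G" "x \<in> carrier G" "y \<in> carrier G"
      "v \<in> carrier G" "w \<in> carrier G"
    and pq: "p \<otimes> q = q \<otimes> p" and xy: "x \<otimes> y = y \<otimes> x"
    and py: "p \<otimes> y = y \<otimes> p \<otimes> v" and xq: "x \<otimes> q = q \<otimes> x \<otimes> w"
    and v: "v \<otimes> p = p \<otimes> v" "v \<otimes> q = q \<otimes> v" "v \<otimes> x = x \<otimes> v" "v \<otimes> y = y \<otimes> v"
    and w: "w \<otimes> p = p \<otimes> w" "w \<otimes> q = q \<otimes> w" "w \<otimes> x = x \<otimes> w" "w \<otimes> y = y \<otimes> w"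
    and vw: "v \<otimes> w = w \<otimes> v"
    and doubled: "(x \<otimes> p \<otimes> x) \<otimes> (y \<otimes> q \<otimes> y) = (y \<otimes> q \<otimes> y) \<otimes> (x \<otimes> p \<otimes> x)"
  shows "(p \<otimes> x) \<otimes> (q \<otimes> y) = (q \<otimes> y) \<otimes> (p \<otimes> x)"
proof -
  define L where "L = p \<otimes> x \<otimes> q \<otimes> y"
  define R where "R = q \<otimes> y \<otimes> p \<otimes> x"
  have LG: "L \<in> carrier G" "R \<in> carrier G" using G by (auto simp: L_def R_def)
  have py': "p \<otimes> (y \<otimes> z) = y \<otimes> (p \<otimes> (v \<otimes> z))" if "z \<in> carrier G" for z
    using py G that by (metis m_assoc m_closed)
  have xq': "x \<otimes> (q \<otimes> z) = q \<otimes> (x \<otimes> (w \<otimes> z))" if "z \<in> carrier G" for z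
    using xq G that by (metis m_assoc m_closed)
  have xy': "x \<otimes> (y \<otimes> z) = y \<otimes> (x \<otimes> z)" if "z \<in> carrier G" for z
    using xy G that by (metis m_assoc m_closed)
  have pq': "p \<otimes> (q \<otimes> z) = q \<otimes> (p \<otimes> z)" if "z \<in> carrier G" for z
    using pq G that by (metis m_assoc m_closed)
  have swap: "a \<otimes> (b \<otimes> z) = b \<otimes> (a \<otimes> z)"
    if "a \<otimes> b = b \<otimes> a" "a \<in> carrier G" "b \<in> carrier G" "z \<in> carrier G" for a b z
    using that by (metis m_assoc)
  note v' = swap[OF v(1)] swap[OF v(2)] swap[OF v(3)] swap[OF v(4)]
  note w' = swap[OF w(1)] swap[OF w(2)] swap[OF w(3)] swap[OF w(4)]
  have "x \<otimes> p \<otimes> x \<otimes> (y \<otimes> q \<otimes> y) = y \<otimes> (x \<otimes> (L \<otimes> v))"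
    using G by (simp add: L_def m_assoc xy' py' v v')
  moreover have "y \<otimes> (x \<otimes> R) = (y \<otimes> q \<otimes> y \<otimes> (x \<otimes> p \<otimes> x)) \<otimes> w"
    using G by (simp add: R_def m_assoc xy' xq' w w')
  ultimately have "y \<otimes> (x \<otimes> R) = y \<otimes> (x \<otimes> (L \<otimes> v)) \<otimes> w"
    by (simp only: doubled)
  then have 1: "R = L \<otimes> (v \<otimes> w)" using G LG by (simp add: m_assoc)
  have 2: "L = R \<otimes> (v \<otimes> w)"
    using G by (simp add: L_def R_def m_assoc xq' xy' xy pq' py' v v' w w' vw)
  have "L \<otimes> ((v \<otimes> w) \<otimes> (v \<otimes> w)) = L" using 1 2 G LG by (simp add: m_assoc)
  then have "(v \<otimes> w) \<otimes> (v \<otimes> w) = \<one>" using G LG by (metis l_cancel m_closed one_closed r_one)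
  then have "v \<otimes> w = \<one>" using eq_one_if_square_eq_one[OF odd m_closed[OF G(5,6)]] by blast
  then have "L = R" using 1 LG by simp
  then show ?thesis using G by (simp add: L_def R_def m_assoc)
qed

text \<open>
  The commutator \<open>z\<close> is central in the group generated by \<open>x\<close> and \<open>y\<close>, so
  \<open>y\<^sup>n x = x y\<^sup>n z\<^sup>n\<close>, which at \<open>n = e\<close> gives \<open>z\<^sup>e = 1\<close>, and
  \<open>(x y)\<^sup>n = x\<^sup>n y\<^sup>n z\<^bsup>n(n-1)/2\<^esup>\<close>. For odd \<open>e\<close> the number \<open>e(e-1)/2\<close> is a multiple of \<open>e\<close>.
\<close>

lemma (in group) pow_mult_eq_one_if_class_two:
  assumes e: "odd (e::nat)"
    and G: "x \<in> carrier G" "y \<in> carrier G" "z \<in> carrier G"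
    and yx: "y \<otimes> x = x \<otimes> y \<otimes> z" and zx: "z \<otimes> x = x \<otimes> z" and zy: "z \<otimes> y = y \<otimes> z"
    and xe: "x [^] e = \<one>" and ye: "y [^] e = \<one>"
  shows "(x \<otimes> y) [^] e = \<one>"
proof -
  have znx: "z [^] (n::nat) \<otimes> x = x \<otimes> z [^] n" "z [^] (n::nat) \<otimes> y = y \<otimes> z [^] n" for n
    using group_commutes_pow zx zy G by auto
  have ynx: "y [^] n \<otimes> x = x \<otimes> y [^] n \<otimes> z [^] n" for n :: nat
  proof (induction n)
    case (Suc n)
    have "y [^] Suc n \<otimes> x = y [^] n \<otimes> x \<otimes> (y \<otimes> z)" using G yx by (simp add: m_assoc)
    also have "\<dots> = x \<otimes> y [^] n \<otimes> (z [^] n \<otimes> y) \<otimes> z" using G Suc by (simp add: m_assoc)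
    also have "\<dots> = x \<otimes> y [^] Suc n \<otimes> z [^] Suc n" using G by (simp only: znx) (simp add: m_assoc)
    finally show ?case .
  qed (use G in simp)
  have "x \<otimes> \<one> = x \<otimes> z [^] e" using ynx[of e] ye G by simp
  then have ze: "z [^] e = \<one>" using G by (metis l_cancel nat_pow_closed one_closed)
  have pow: "(x \<otimes> y) [^] n = x [^] n \<otimes> y [^] n \<otimes> z [^] (\<Sum>{..<n})" for n :: nat
  proof (induction n)
    case (Suc n)
    let ?t = "\<Sum>{..<n}"
    have znx': "z [^] k \<otimes> (x \<otimes> u) = x \<otimes> (z [^] k \<otimes> u)"
      "z [^] k \<otimes> (y \<otimes> u) = y \<otimes> (z [^] k \<otimes> u)" if "u \<in> carrier G" for u and k :: nat
      using znx[of k] G that by (simp_all add: m_assoc[symmetric])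
    have ynx': "y [^] n \<otimes> (x \<otimes> u) = x \<otimes> (y [^] n \<otimes> (z [^] n \<otimes> u))" if "u \<in> carrier G" for u
      using ynx[of n] G that by (metis m_assoc m_closed nat_pow_closed)
    have "(x \<otimes> y) [^] Suc n = x [^] Suc n \<otimes> y [^] Suc n \<otimes> (z [^] n \<otimes> z [^] ?t)"
      using G Suc by (simp add: m_assoc znx' znx ynx')
    also have "z [^] n \<otimes> z [^] ?t = z [^] (\<Sum>{..<Suc n})" using G by (simp add: nat_pow_mult add.commute)
    finally show ?case .
  qed (use G in simp)
  have double: "2 * \<Sum>{..<k} = k * (k - 1)" for k :: nat
  proof (induction k)
    case (Suc k)
    then show ?case by (cases k) (auto simp: algebra_simps)
  qed simp
  have "e dvd 2 * \<Sum>{..<e}" unfolding double by simp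
  then have "e dvd \<Sum>{..<e}" using e by (simp add: coprime_dvd_mult_right_iff)
  then obtain k where "\<Sum>{..<e} = e * k" by blast
  then have "z [^] (\<Sum>{..<e}) = \<one>" using ze G by (simp add: nat_pow_pow[symmetric])
  then show ?thesis using pow[of e] xe ye G by simp
qed

section \<open>The abelian subgroup attached to one element of B\<close>

lemma (in group) middle_swap:
  assumes "z \<otimes> c = c \<otimes> z"
    and "a \<in> carrier G" "z \<in> carrier G" "c \<in> carrier G" "w \<in> carrier G"
  shows "(a \<otimes> z) \<otimes> (c \<otimes> w) = (a \<otimes> c) \<otimes> (z \<otimes> w)"
proof -
  have "(a \<otimes> z) \<otimes> (c \<otimes> w) = a \<otimes> (z \<otimes> c) \<otimes> w" using assms(2-) by (simp add: m_assoc)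
  also have "\<dots> = a \<otimes> (c \<otimes> z) \<otimes> w" by (simp only: assms(1))
  finally show ?thesis using assms(2-) by (simp add: m_assoc)
qed

lemma (in group) commute_mult:
  assumes "t \<in> carrier G" "x \<in> carrier G" "y \<in> carrier G" "t \<otimes> x = x \<otimes> t" "t \<otimes> y = y \<otimes> t"
  shows "t \<otimes> (x \<otimes> y) = x \<otimes> y \<otimes> t"
  using assms by (metis m_assoc)

text \<open>
  The last two assumptions say that \<open>A\<close> and its conjugate by \<open>b\<close> normalize each other. In particular
  the two generate a group of class at most two, in which their intersection is central.
\<close>

locale replacement = group G for G :: "('a, 'b) monoid_scheme" (structure) +
  fixes A B :: "'a set" and b :: 'a
  assumes fin: "finite (carrier G)" and odd_order: "odd (order G)"
    and A: "subgroup A G" and A_comm: "\<And>x y. x \<in> A \<Longrightarrow> y \<in> A \<Longrightarrow> x \<otimes> y = y \<otimes> x"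
    and B: "subgroup B G" and b: "b \<in> B"
    and commutators_B: "\<And>x y. x \<in> B \<Longrightarrow> y \<in> B \<Longrightarrow> x \<otimes> y \<otimes> inv x \<otimes> inv y \<in> A"
    and A_normalizes_B: "\<And>a x. a \<in> A \<Longrightarrow> x \<in> B \<Longrightarrow> a \<otimes> x \<otimes> inv a \<in> B"
    and conjugate_normalizes: "\<And>a c. a \<in> A \<Longrightarrow> c \<in> A \<Longrightarrow>
      (b \<otimes> c \<otimes> inv b) \<otimes> a \<otimes> inv (b \<otimes> c \<otimes> inv b) \<in> A"
    and normalizes_conjugate: "\<And>a c. a \<in> A \<Longrightarrow> c \<in> A \<Longrightarrow>
      c \<otimes> (b \<otimes> a \<otimes> inv b) \<otimes> inv c \<in> (\<lambda>x. b \<otimes> x \<otimes> inv b) ` A"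
begin

definition \<phi> :: "'a \<Rightarrow> 'a" where "\<phi> x = b \<otimes> x \<otimes> inv b"

definition Z :: "'a set" where "Z = A \<inter> \<phi> ` A"

definition \<delta> :: "'a \<Rightarrow> 'a" where "\<delta> a = inv a \<otimes> \<phi> a"

definition C :: "'a set" where "C = (\<lambda>(a, z). \<delta> a \<otimes> z) ` (A \<times> Z)"

lemma A_carrier: "a \<in> A \<Longrightarrow> a \<in> carrier G" by (rule subgroup.mem_carrier[OF A])
lemma B_carrier: "a \<in> B \<Longrightarrow> a \<in> carrier G" by (rule subgroup.mem_carrier[OF B])
lemma finite_A: "finite A" by (rule finite_subset[OF subgroup.subset[OF A] fin])
lemma b_carrier: "b \<in> carrier G" by (rule B_carrier[OF b])
lemmas A_closed = subgroup.m_closed[OF A] subgroup.m_inv_closed[OF A] subgroup.one_closed[OF A]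
lemmas B_closed = subgroup.m_closed[OF B] subgroup.m_inv_closed[OF B] subgroup.one_closed[OF B]

lemma \<phi>_carrier: "x \<in> carrier G \<Longrightarrow> \<phi> x \<in> carrier G"
  using b_carrier by (simp add: \<phi>_def)

lemma \<phi>_mult: "x \<in> carrier G \<Longrightarrow> y \<in> carrier G \<Longrightarrow> \<phi> (x \<otimes> y) = \<phi> x \<otimes> \<phi> y"
  using b_carrier by (simp add: \<phi>_def m_assoc cancel_inv_left)

lemma \<phi>_group_hom: "group_hom G G \<phi>"
  using \<phi>_carrier \<phi>_mult by unfold_locales (auto simp: hom_def)

lemma \<phi>_inv: "x \<in> carrier G \<Longrightarrow> \<phi> (inv x) = inv (\<phi> x)"
  by (rule group_hom.hom_inv[OF \<phi>_group_hom])

lemma \<phi>_pow: "x \<in> carrier G \<Longrightarrow> \<phi> (x [^] (n::nat)) = \<phi> x [^] n"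
  by (rule group_hom.hom_nat_pow[OF \<phi>_group_hom])

lemma \<phi>_one: "\<phi> \<one> = \<one>"
  by (rule group_hom.hom_one[OF \<phi>_group_hom])

lemma \<phi>_inj: "x \<in> carrier G \<Longrightarrow> y \<in> carrier G \<Longrightarrow> \<phi> x = \<phi> y \<longleftrightarrow> x = y"
  using b_carrier by (simp add: \<phi>_def)

lemma \<phi>_B: "x \<in> B \<Longrightarrow> \<phi> x \<in> B"
  using b by (simp add: \<phi>_def B_closed)

lemma \<phi>A: "subgroup (\<phi> ` A) G"
  using group_hom.subgroup_img_is_subgroup[OF \<phi>_group_hom A] .

lemma \<phi>A_comm: "x \<in> \<phi> ` A \<Longrightarrow> y \<in> \<phi> ` A \<Longrightarrow> x \<otimes> y = y \<otimes> x"
  by (auto simp: \<phi>_mult[symmetric] A_carrier A_comm)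

lemma Z: "subgroup Z G"
  unfolding Z_def by (rule subgroups_Inter_pair[OF A \<phi>A])

lemmas Z_closed = subgroup.m_closed[OF Z] subgroup.m_inv_closed[OF Z] subgroup.one_closed[OF Z]

lemma Z_carrier: "z \<in> Z \<Longrightarrow> z \<in> carrier G" by (rule subgroup.mem_carrier[OF Z])

lemma Z_central: "z \<in> Z \<Longrightarrow> x \<in> A \<union> \<phi> ` A \<Longrightarrow> z \<otimes> x = x \<otimes> z"
  unfolding Z_def using A_comm \<phi>A_comm by blast

text \<open>
  The commutator of \<open>a\<close> and \<open>y\<close> is a product of two elements of \<open>A\<close>, because \<open>y\<close> normalizes \<open>A\<close>,
  and a product of two elements of \<open>\<phi> A\<close>, because \<open>a\<close> normalizes \<open>\<phi> A\<close>.
\<close>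

lemma commutator_in_Z:
  assumes a: "a \<in> A" and y: "y \<in> \<phi> ` A"
  shows "\<exists>z \<in> Z. a \<otimes> y = y \<otimes> a \<otimes> z"
proof -
  obtain c where c: "c \<in> A" and yc: "y = \<phi> c" using y by blast
  have G: "a \<in> carrier G" "y \<in> carrier G" using A_carrier a subgroup.mem_carrier[OF \<phi>A y] by auto
  let ?z = "inv a \<otimes> inv y \<otimes> a \<otimes> y"
  have "inv y \<otimes> a \<otimes> y \<in> A"
    using conjugate_normalizes[OF a, of "inv c"] c b_carrier A_carrier[OF c]
    by (simp add: A_closed yc \<phi>_def m_assoc inv_mult_group)
  then have 1: "?z \<in> A" using A_closed a G by (simp add: m_assoc)
  have "inv a \<otimes> \<phi> (inv c) \<otimes> a \<in> \<phi> ` A"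
    using normalizes_conjugate[of "inv c" "inv a"] c a G
    unfolding \<phi>_def by (simp add: A_closed)
  then have "inv a \<otimes> inv y \<otimes> a \<in> \<phi> ` A" using yc \<phi>_inv[OF A_carrier[OF c]] by simp
  then have "?z \<in> \<phi> ` A" using y subgroup.m_closed[OF \<phi>A] by blast
  then have "?z \<in> Z" using 1 by (simp add: Z_def)
  moreover have "a \<otimes> y = y \<otimes> a \<otimes> ?z" using G by (simp add: m_assoc cancel_inv_left)
  ultimately show ?thesis by blast
qed

text \<open>
  \<open>A \<inter> B\<close> is normal in \<open>B\<close> because it contains all commutators of \<open>B\<close>.
\<close>

lemma \<phi>_Int: "x \<in> A \<inter> B \<Longrightarrow> \<phi> x \<in> A \<inter> B"
proof -
  assume x: "x \<in> A \<inter> B"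
  then have "\<phi> x = (b \<otimes> x \<otimes> inv b \<otimes> inv x) \<otimes> x"
    using b_carrier A_carrier by (simp add: \<phi>_def m_assoc)
  moreover have "b \<otimes> x \<otimes> inv b \<otimes> inv x \<in> A" using x b commutators_B by blast
  ultimately have "\<phi> x \<in> A" using x A_closed(1) by auto
  then show "\<phi> x \<in> A \<inter> B" using x \<phi>_B by blast
qed

lemma Int_image: "\<phi> ` (A \<inter> B) = A \<inter> B"
proof (rule endo_inj_surj)
  show "finite (A \<inter> B)" using finite_A by blast
  show "inj_on \<phi> (A \<inter> B)" using \<phi>_inj A_carrier by (auto intro: inj_onI)
qed (use \<phi>_Int in blast)

lemma Int_sub_Z: "A \<inter> B \<subseteq> Z"
  using Int_image by (auto simp: Z_def)

lemma \<delta>_in_B: "a \<in> A \<Longrightarrow> \<delta> a \<in> B"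
proof -
  assume a: "a \<in> A"
  have "\<delta> a = (inv a \<otimes> b \<otimes> inv (inv a)) \<otimes> inv b"
    using a A_carrier b_carrier by (simp add: \<delta>_def \<phi>_def m_assoc)
  then show "\<delta> a \<in> B" using A_normalizes_B[of "inv a" b] a b A_closed B_closed by auto
qed

text \<open>
  If \<open>k\<close> and \<open>\<phi> k\<close> are in \<open>A\<close>, then \<open>\<delta> k \<in> A \<inter> B = \<phi> (A \<inter> B)\<close>, so \<open>k = \<phi> k (\<delta> k)\<^bsup>-1\<^esup>\<close> is in \<open>\<phi> A\<close>
  as well. The converse is a count, since \<open>\<phi>\<close> maps the set on the right bijectively to \<open>Z\<close>. The lemma
  makes \<open>Z\<close> invariant under \<open>\<phi>\<close> and identifies it as the kernel of \<open>\<delta>\<close> modulo \<open>Z\<close>; without it, \<open>C\<close>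
  could be larger than \<open>A\<close>.
\<close>

lemma in_Z_iff: "k \<in> Z \<longleftrightarrow> k \<in> A \<and> \<phi> k \<in> A"
proof -
  have sub: "k \<in> Z" if "k \<in> A" "\<phi> k \<in> A" for k
  proof -
    have G: "k \<in> carrier G" "\<phi> k \<in> carrier G" using that A_carrier by auto
    have "\<delta> k \<in> A \<inter> B" using that \<delta>_in_B A_closed by (simp add: \<delta>_def)
    then have "\<delta> k \<in> \<phi> ` A" using Int_image by blast
    then have "\<phi> k \<otimes> inv (\<delta> k) \<in> \<phi> ` A"
      using that subgroup.m_closed[OF \<phi>A] subgroup.m_inv_closed[OF \<phi>A] by blast
    moreover have "\<phi> k \<otimes> inv (\<delta> k) = k"
      using G by (simp add: \<delta>_def inv_mult_group cancel_inv_left)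
    ultimately show ?thesis using that by (simp add: Z_def)
  qed
  let ?E = "{k \<in> A. \<phi> k \<in> A}"
  have finZ: "finite Z" using finite_A by (simp add: Z_def)
  have inj: "inj_on \<phi> ?E" using \<phi>_inj A_carrier by (auto intro: inj_onI)
  have "\<phi> ` ?E = Z" by (auto simp: Z_def)
  then have "card ?E = card Z" using card_image[OF inj] by simp
  moreover have "?E \<subseteq> Z" using sub by blast
  ultimately have "?E = Z" using card_subset_eq[OF finZ] by blast
  then show ?thesis by blast
qed

lemma \<phi>_Z: "z \<in> Z \<Longrightarrow> \<phi> z \<in> Z"
  using in_Z_iff by (auto simp: Z_def)

lemma \<delta>_carrier: "a \<in> A \<Longrightarrow> \<delta> a \<in> carrier G"
  using A_carrier \<phi>_carrier by (simp add: \<delta>_def)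

text \<open>
  Since \<open>\<delta> a\<close> and \<open>b\<close> are in \<open>B\<close>, their commutator is in \<open>A \<inter> B \<subseteq> Z\<close>, that is, \<open>\<phi> (\<delta> a) = \<delta> a\<close> up
  to a factor in \<open>Z\<close>.
\<close>

lemma second_conjugate:
  assumes a: "a \<in> A"
  shows "\<exists>t \<in> Z. \<phi> (\<phi> a) = \<phi> a \<otimes> inv a \<otimes> \<phi> a \<otimes> t"
proof -
  have G: "a \<in> carrier G" "\<phi> a \<in> carrier G" "\<delta> a \<in> carrier G" "\<phi> (\<delta> a) \<in> carrier G"
    using a A_carrier \<phi>_carrier \<delta>_carrier by auto
  let ?t = "inv (\<delta> a) \<otimes> b \<otimes> inv (inv (\<delta> a)) \<otimes> inv b"
  have "?t \<in> A \<inter> B"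
    using a \<delta>_in_B b B_closed commutators_B[of "inv (\<delta> a)" b] by simp
  then have tZ: "?t \<in> Z" using Int_sub_Z by blast
  have "\<phi> (\<delta> a) = \<delta> a \<otimes> ?t"
    using G b_carrier by (simp add: \<phi>_def[of "\<delta> a"] m_assoc cancel_inv_left)
  moreover have "\<phi> (\<delta> a) = inv (\<phi> a) \<otimes> \<phi> (\<phi> a)"
    using G by (simp add: \<delta>_def \<phi>_mult \<phi>_inv)
  ultimately have "\<phi> (\<phi> a) = \<phi> a \<otimes> (\<delta> a \<otimes> ?t)"
    using G \<phi>_carrier by (metis cancel_inv_left(2))
  also have "\<dots> = \<phi> a \<otimes> inv a \<otimes> \<phi> a \<otimes> ?t"
    using G Z_carrier[OF tZ] by (simp add: \<delta>_def[of a] m_assoc)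
  finally show ?thesis using tZ by blast
qed

text \<open>
  The conjugates of \<open>a\<close> and \<open>c\<close> by the square of \<open>b\<close> commute, because \<open>a\<close> and \<open>c\<close> do. By the previous
  lemma this means that \<open>\<phi> a a\<^bsup>-1\<^esup> \<phi> a\<close> and \<open>\<phi> c c\<^bsup>-1\<^esup> \<phi> c\<close> commute, and oddness of the order lets
  the same hold for \<open>a\<^bsup>-1\<^esup> \<phi> a\<close> and \<open>c\<^bsup>-1\<^esup> \<phi> c\<close>.
\<close>

lemma \<delta>_comm:
  assumes a: "a \<in> A" and c: "c \<in> A"
  shows "\<delta> a \<otimes> \<delta> c = \<delta> c \<otimes> \<delta> a"
proof -
  let ?x = "\<phi> a" and ?y = "\<phi> c"
  have G: "a \<in> carrier G" "c \<in> carrier G" "?x \<in> carrier G" "?y \<in> carrier G"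
    using a c A_carrier \<phi>_carrier by auto
  have mem: "inv a \<in> A" "inv c \<in> A" "?x \<in> \<phi> ` A" "?y \<in> \<phi> ` A" using a c A_closed by auto
  obtain v where v: "v \<in> Z" "inv a \<otimes> ?y = ?y \<otimes> inv a \<otimes> v"
    using commutator_in_Z[of "inv a" ?y] mem by blast
  obtain w' where w': "w' \<in> Z" "inv c \<otimes> ?x = ?x \<otimes> inv c \<otimes> w'"
    using commutator_in_Z[of "inv c" ?x] mem by blast
  have w: "inv w' \<in> Z" using Z_closed w' by blast
  have "?x \<otimes> inv c \<otimes> w' \<otimes> inv w' = ?x \<otimes> inv c"
    using G Z_carrier[OF w'(1)] by (simp add: m_assoc)
  then have xq: "?x \<otimes> inv c = inv c \<otimes> ?x \<otimes> inv w'" using w'(2) by simp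
  have central: "z \<otimes> inv a = inv a \<otimes> z" "z \<otimes> inv c = inv c \<otimes> z" "z \<otimes> ?x = ?x \<otimes> z" "z \<otimes> ?y = ?y \<otimes> z"
    if "z \<in> Z" for z
    using Z_central[OF that] mem by blast+
  obtain t where t: "t \<in> Z" "\<phi> ?x = ?x \<otimes> inv a \<otimes> ?x \<otimes> t" using second_conjugate[OF a] by blast
  obtain s where s: "s \<in> Z" "\<phi> ?y = ?y \<otimes> inv c \<otimes> ?y \<otimes> s" using second_conjugate[OF c] by blast
  let ?X = "?x \<otimes> inv a \<otimes> ?x" and ?Y = "?y \<otimes> inv c \<otimes> ?y"
  have XY: "?X \<in> carrier G" "?Y \<in> carrier G" using G by auto
  have tsG: "t \<in> carrier G" "s \<in> carrier G" using t s Z_carrier by auto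
  have tY: "t \<otimes> ?Y = ?Y \<otimes> t" "s \<otimes> ?X = ?X \<otimes> s"
    using central[OF t(1)] central[OF s(1)] G tsG by (simp_all add: commute_mult)
  have ts: "t \<otimes> s = s \<otimes> t" using t(1) s(1) A_comm by (simp add: Z_def)
  have "\<phi> ?x \<otimes> \<phi> ?y = \<phi> ?y \<otimes> \<phi> ?x"
    using \<phi>_mult G A_comm[OF a c] by metis
  then have "?X \<otimes> t \<otimes> (?Y \<otimes> s) = ?Y \<otimes> s \<otimes> (?X \<otimes> t)" unfolding t(2) s(2) .
  moreover have "?X \<otimes> t \<otimes> (?Y \<otimes> s) = ?X \<otimes> ?Y \<otimes> (t \<otimes> s)"
    by (rule middle_swap) (fact tY XY tsG)+
  moreover have "?Y \<otimes> s \<otimes> (?X \<otimes> t) = ?Y \<otimes> ?X \<otimes> (t \<otimes> s)"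
    unfolding ts by (rule middle_swap) (fact tY XY tsG)+
  ultimately have "?X \<otimes> ?Y = ?Y \<otimes> ?X" using XY tsG by (metis m_closed r_cancel)
  moreover have "v \<otimes> inv w' = inv w' \<otimes> v" using v w A_comm by (simp add: Z_def)
  ultimately show ?thesis unfolding \<delta>_def
    by (intro commute_if_doubled_commute[OF odd_order inv_closed[OF G(1)] inv_closed[OF G(2)] G(3,4)
      Z_carrier[OF v(1)] Z_carrier[OF w] A_comm[OF mem(1,2)] \<phi>A_comm[OF mem(3,4)] v(2) xq
      central[OF v(1)] central[OF w]])
qed

lemma Z_\<delta>: "z \<in> Z \<Longrightarrow> a \<in> A \<Longrightarrow> z \<otimes> \<delta> a = \<delta> a \<otimes> z"
proof -
  assume z: "z \<in> Z" and a: "a \<in> A"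
  have "z \<otimes> inv a = inv a \<otimes> z" "z \<otimes> \<phi> a = \<phi> a \<otimes> z"
    using Z_central[OF z] a A_closed by blast+
  then show "z \<otimes> \<delta> a = \<delta> a \<otimes> z"
    unfolding \<delta>_def using Z_carrier[OF z] a A_carrier \<phi>_carrier by (intro commute_mult) auto
qed

lemma CI: "a \<in> A \<Longrightarrow> z \<in> Z \<Longrightarrow> \<delta> a \<otimes> z \<in> C"
  unfolding C_def by (rule image_eqI[of _ _ "(a, z)"]) auto

lemma CE: assumes "x \<in> C" obtains a z where "a \<in> A" "z \<in> Z" "x = \<delta> a \<otimes> z"
  using assms by (auto simp: C_def)

lemma \<delta>_mult:
  assumes a: "a \<in> A" and c: "c \<in> A"
  shows "\<exists>z \<in> Z. \<delta> a \<otimes> \<delta> c = \<delta> (a \<otimes> c) \<otimes> z"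
proof -
  have G: "a \<in> carrier G" "c \<in> carrier G" "\<phi> a \<in> carrier G" "\<phi> c \<in> carrier G"
    using a c A_carrier \<phi>_carrier by auto
  obtain z where z: "z \<in> Z" "inv c \<otimes> \<phi> a = \<phi> a \<otimes> inv c \<otimes> z"
    using commutator_in_Z[of "inv c" "\<phi> a"] a c A_closed by blast
  have zG: "z \<in> carrier G" by (rule Z_carrier[OF z(1)])
  have zc: "inv z \<otimes> \<phi> c = \<phi> c \<otimes> inv z" using Z_central[of "inv z" "\<phi> c"] z Z_closed c by blast
  have "\<phi> a \<otimes> inv c \<otimes> z \<otimes> inv z = \<phi> a \<otimes> inv c" using G zG by (simp add: m_assoc)
  then have swap: "\<phi> a \<otimes> inv c = inv c \<otimes> \<phi> a \<otimes> inv z" using z(2) by simp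
  have "\<delta> a \<otimes> \<delta> c = inv a \<otimes> (\<phi> a \<otimes> inv c) \<otimes> \<phi> c" using G by (simp add: \<delta>_def m_assoc)
  also have "\<dots> = inv a \<otimes> (inv c \<otimes> \<phi> a \<otimes> inv z) \<otimes> \<phi> c" by (simp only: swap)
  also have "\<dots> = inv a \<otimes> inv c \<otimes> (\<phi> a \<otimes> \<phi> c) \<otimes> inv z" using G zG zc by (simp add: m_assoc)
  also have "inv a \<otimes> inv c = inv (a \<otimes> c)" using G A_comm[OF a c] by (simp add: inv_mult_group[symmetric])
  finally have "\<delta> a \<otimes> \<delta> c = \<delta> (a \<otimes> c) \<otimes> inv z" using G by (simp add: \<delta>_def \<phi>_mult)
  then show ?thesis using z Z_closed by blast
qed

lemma C_mult_expand:
  assumes "a \<in> A" "z \<in> Z" "c \<in> A" "w \<in> Z"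
  shows "(\<delta> a \<otimes> z) \<otimes> (\<delta> c \<otimes> w) = \<delta> a \<otimes> \<delta> c \<otimes> (z \<otimes> w)"
proof -
  show ?thesis
    by (rule middle_swap[OF Z_\<delta>]) (use assms \<delta>_carrier Z_carrier in auto)
qed

lemma C_comm: "x \<in> C \<Longrightarrow> y \<in> C \<Longrightarrow> x \<otimes> y = y \<otimes> x"
  by (elim CE) (auto simp: C_mult_expand \<delta>_comm Z_def A_comm)

lemma Z_sub_C: "Z \<subseteq> C"
proof
  fix z assume z: "z \<in> Z"
  then have "z = \<delta> \<one> \<otimes> z" using Z_carrier \<phi>_one by (simp add: \<delta>_def)
  then show "z \<in> C" using CI[of \<one> z] z A_closed by simp
qed

lemma C: "subgroup C G"
proof (rule subgroup_of_finite_if_closed[OF fin])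
  show "C \<subseteq> carrier G" using \<delta>_carrier Z_carrier by (auto simp: C_def)
  show "\<one> \<in> C" using Z_sub_C Z_closed by blast
next
  fix x y assume "x \<in> C" "y \<in> C"
  then obtain a z c w where *: "a \<in> A" "z \<in> Z" "x = \<delta> a \<otimes> z" "c \<in> A" "w \<in> Z" "y = \<delta> c \<otimes> w"
    by (metis CE)
  obtain u where u: "u \<in> Z" "\<delta> a \<otimes> \<delta> c = \<delta> (a \<otimes> c) \<otimes> u" using \<delta>_mult * by blast
  have ac: "a \<otimes> c \<in> A" using * A_closed by blast
  have "x \<otimes> y = \<delta> a \<otimes> \<delta> c \<otimes> (z \<otimes> w)" unfolding *(3,6) by (rule C_mult_expand) (fact *)+
  also have "\<dots> = \<delta> (a \<otimes> c) \<otimes> (u \<otimes> (z \<otimes> w))"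
    unfolding u(2) using * u ac \<delta>_carrier Z_carrier by (simp add: m_assoc)
  finally have "x \<otimes> y = \<delta> (a \<otimes> c) \<otimes> (u \<otimes> (z \<otimes> w))" .
  then show "x \<otimes> y \<in> C" using CI[OF ac, of "u \<otimes> (z \<otimes> w)"] * u Z_closed by simp
qed

text \<open>
  Modulo \<open>Z\<close> the map \<open>\<delta>\<close> is a homomorphism on \<open>A\<close> with kernel \<open>Z\<close>. The assumption on \<open>\<phi>\<close> makes each
  \<open>\<delta> k\<close> with \<open>k \<in> P \<inter> Z\<close> an element of \<open>P \<inter> Z\<close>, so that all fibres of \<open>(a, z) \<mapsto> \<delta> a z\<close> have the
  size of \<open>P \<inter> Z\<close>. The lemma is for \<open>P = A\<close>, where the image is \<open>C\<close>, and for the subgroup of all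
  \<open>a \<in> A\<close> with \<open>a\<^sup>e = 1\<close>, where for odd \<open>e\<close> the image consists of elements of \<open>C\<close> with the same
  property.
\<close>

lemma card_replacement:
  assumes P: "subgroup P G" "P \<subseteq> A" and inv: "\<And>k. k \<in> P \<inter> Z \<Longrightarrow> \<phi> k \<in> P"
  shows "card ((\<lambda>(a, z). \<delta> a \<otimes> z) ` (P \<times> (P \<inter> Z))) = card P"
proof -
  let ?f = "\<lambda>(a, z). \<delta> a \<otimes> z" and ?Q = "P \<inter> Z"
  have finP: "finite P" by (rule finite_subset[OF P(2) finite_A])
  have Q: "subgroup ?Q G" by (rule subgroups_Inter_pair[OF P(1) Z])
  note Q_closed = subgroup.m_closed[OF Q] subgroup.m_inv_closed[OF Q] subgroup.one_closed[OF Q]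
  \<comment> \<open>Elements of \<open>Z\<close> are central, so \<open>\<delta> (k c)\<close> is the product of \<open>\<delta> c\<close> and \<open>\<delta> k\<close> without a correction.\<close>
  have shift: "\<delta> (k \<otimes> c) \<otimes> u = \<delta> c \<otimes> (inv k \<otimes> \<phi> k \<otimes> u)"
    if k: "k \<in> Z" and c: "c \<in> A" and u: "u \<in> carrier G" for k c u
  proof -
    have G: "k \<in> carrier G" "c \<in> carrier G" "\<phi> k \<in> carrier G" "\<phi> c \<in> carrier G"
      using k c Z_carrier A_carrier \<phi>_carrier by auto
    have "inv k \<in> Z" "\<phi> k \<in> Z" using k Z_closed \<phi>_Z by auto
    then have 1: "inv k \<otimes> \<phi> c = \<phi> c \<otimes> inv k" "\<phi> k \<otimes> \<phi> c = \<phi> c \<otimes> \<phi> k"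
      using Z_central c by blast+
    have "\<delta> (k \<otimes> c) \<otimes> u = inv c \<otimes> (inv k \<otimes> (\<phi> k \<otimes> \<phi> c)) \<otimes> u"
      using G u by (simp add: \<delta>_def \<phi>_mult inv_mult_group m_assoc)
    also have "\<dots> = inv c \<otimes> ((inv k \<otimes> \<phi> c) \<otimes> \<phi> k) \<otimes> u" using G u 1(2) by (simp add: m_assoc)
    also have "\<dots> = \<delta> c \<otimes> (inv k \<otimes> \<phi> k \<otimes> u)" using G u 1(1) by (simp add: \<delta>_def m_assoc)
    finally show ?thesis .
  qed
  have fibre: "card {x \<in> P \<times> ?Q. ?f x = y} = card ?Q" if yin: "y \<in> ?f ` (P \<times> ?Q)" for y
  proof -
    obtain c w where c: "c \<in> P" and w: "w \<in> ?Q" and y: "y = \<delta> c \<otimes> w" using yin by auto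
    have cA: "c \<in> A" and wZ: "w \<in> Z" using c w P by auto
    have cG: "c \<in> carrier G" "w \<in> carrier G" "\<phi> c \<in> carrier G"
      using cA wZ A_carrier Z_carrier \<phi>_carrier by auto
    \<comment> \<open>The fibre is parametrized by \<open>k = a c\<^bsup>-1\<^esup>\<close>; the second component absorbs \<open>\<delta> k\<close>.\<close>
    let ?g = "\<lambda>k. (k \<otimes> c, inv (\<phi> k) \<otimes> k \<otimes> w)"
    have "bij_betw ?g ?Q {x \<in> P \<times> ?Q. ?f x = y}"
    proof (rule bij_betw_byWitness[where f' = "\<lambda>(a, z). a \<otimes> inv c"])
      show "\<forall>k \<in> ?Q. (case ?g k of (a, z) \<Rightarrow> a \<otimes> inv c) = k"
        using cG Z_carrier by (auto simp: m_assoc)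
      show "?g ` ?Q \<subseteq> {x \<in> P \<times> ?Q. ?f x = y}"
      proof
        fix x assume "x \<in> ?g ` ?Q"
        then obtain k where k: "k \<in> ?Q" and x: "x = ?g k" by blast
        have "\<phi> k \<in> ?Q" using k inv \<phi>_Z by blast
        then have z: "inv (\<phi> k) \<otimes> k \<otimes> w \<in> ?Q" by (intro Q_closed k w)
        have "k \<otimes> c \<in> P" using k c subgroup.m_closed[OF P(1)] by blast
        moreover have "k \<in> carrier G" "\<phi> k \<in> carrier G" using k Z_carrier \<phi>_carrier by auto
        then have "\<delta> (k \<otimes> c) \<otimes> (inv (\<phi> k) \<otimes> k \<otimes> w) = y"
          using shift[of k c "inv (\<phi> k) \<otimes> k \<otimes> w"] k cA cG y by (simp add: m_assoc cancel_inv_left)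
        ultimately show "x \<in> {x \<in> P \<times> ?Q. ?f x = y}" using x z by simp
      qed
      have ker: "a \<otimes> inv c \<in> ?Q \<and> z = inv (\<phi> (a \<otimes> inv c)) \<otimes> (a \<otimes> inv c) \<otimes> w"
        if a: "a \<in> P" and z: "z \<in> ?Q" and eq: "\<delta> a \<otimes> z = y" for a z
      proof -
        let ?k = "a \<otimes> inv c"
        have aA: "a \<in> A" and zZ: "z \<in> Z" using a z P by auto
        have aG: "a \<in> carrier G" "z \<in> carrier G" "\<phi> a \<in> carrier G"
          using aA zZ A_carrier Z_carrier \<phi>_carrier by auto
        have kA: "?k \<in> A" and kP: "?k \<in> P"
          using aA cA A_closed a c subgroup.m_closed[OF P(1)] subgroup.m_inv_closed[OF P(1)] by auto
        have kG: "?k \<in> carrier G" "\<phi> ?k \<in> carrier G" using kA A_carrier \<phi>_carrier by auto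
        have "\<phi> a \<otimes> z = a \<otimes> (\<delta> a \<otimes> z)" using aG by (simp add: \<delta>_def m_assoc cancel_inv_left)
        also have "\<dots> = ?k \<otimes> \<phi> c \<otimes> w" using eq y aG cG by (simp add: \<delta>_def m_assoc)
        finally have 1: "\<phi> a \<otimes> z = ?k \<otimes> \<phi> c \<otimes> w" .
        obtain u where u: "u \<in> Z" "?k \<otimes> \<phi> c = \<phi> c \<otimes> ?k \<otimes> u"
          using commutator_in_Z[OF kA, of "\<phi> c"] cA by blast
        have uG: "u \<in> carrier G" by (rule Z_carrier[OF u(1)])
        have "?k \<otimes> c = a" using aG cG by (simp add: m_assoc)
        then have "\<phi> a = \<phi> (c \<otimes> ?k)" using A_comm[OF kA cA] by simp
        then have "\<phi> a = \<phi> c \<otimes> \<phi> ?k" using \<phi>_mult cG kG by simp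
        then have "\<phi> c \<otimes> (\<phi> ?k \<otimes> z) = \<phi> c \<otimes> (?k \<otimes> (u \<otimes> w))"
          using 1 u uG aG cG kG by (simp add: m_assoc del: inv_closed)
        then have "\<phi> ?k \<otimes> z = ?k \<otimes> (u \<otimes> w)" using aG cG kG uG by simp
        then have "\<phi> ?k \<otimes> z \<otimes> inv z = ?k \<otimes> (u \<otimes> w) \<otimes> inv z" by simp
        then have "\<phi> ?k = ?k \<otimes> (u \<otimes> w \<otimes> inv z)"
          using aG kG uG cG by (simp add: m_assoc)
        moreover have "u \<otimes> w \<otimes> inv z \<in> A" using u wZ zZ Z_closed by (simp add: Z_def)
        ultimately have "\<phi> ?k \<in> A" using kA A_closed by simp
        then have kZ: "?k \<in> Z" using kA in_Z_iff by blast
        have "\<delta> a = \<delta> c \<otimes> (inv ?k \<otimes> \<phi> ?k)"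
          using shift[OF kZ cA one_closed] \<open>?k \<otimes> c = a\<close> \<delta>_carrier[OF aA] kG by simp
        then have "\<delta> c \<otimes> (inv ?k \<otimes> \<phi> ?k \<otimes> z) = \<delta> c \<otimes> w"
          using eq y \<delta>_carrier[OF cA] kG aG by (simp add: m_assoc)
        then have "inv ?k \<otimes> \<phi> ?k \<otimes> z = w" using \<delta>_carrier[OF cA] kG aG cG by simp
        then have "inv (\<phi> ?k) \<otimes> ?k \<otimes> w = inv (\<phi> ?k) \<otimes> ?k \<otimes> (inv ?k \<otimes> \<phi> ?k \<otimes> z)" by simp
        also have "\<dots> = inv (\<phi> ?k) \<otimes> (?k \<otimes> (inv ?k \<otimes> (\<phi> ?k \<otimes> z)))"
          using kG aG by (simp only: m_assoc inv_closed m_closed)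
        also have "\<dots> = z" using kG aG by (simp only: cancel_inv_left m_closed)
        finally show ?thesis using kZ kP by simp
      qed
      show "\<forall>x \<in> {x \<in> P \<times> ?Q. ?f x = y}. ?g (case x of (a, z) \<Rightarrow> a \<otimes> inv c) = x"
      proof
        fix x assume "x \<in> {x \<in> P \<times> ?Q. ?f x = y}"
        then obtain a z where x: "x = (a, z)" "a \<in> P" "z \<in> ?Q" "\<delta> a \<otimes> z = y" by auto
        have "a \<otimes> inv c \<otimes> c = a" using x P A_carrier cG by (auto simp: m_assoc)
        then show "?g (case x of (a, z) \<Rightarrow> a \<otimes> inv c) = x" using ker[OF x(2,3,4)] x(1) by simp
      qed
      show "(\<lambda>(a, z). a \<otimes> inv c) ` {x \<in> P \<times> ?Q. ?f x = y} \<subseteq> ?Q"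
        using ker by auto
    qed
    then show ?thesis by (simp add: bij_betw_same_card)
  qed
  have "card (P \<times> ?Q) = card ?Q * card (?f ` (P \<times> ?Q))"
    using finP fibre by (intro card_eq_mult_card_image) auto
  moreover have "card ?Q > 0" using finP Q_closed(3) by (auto simp: card_gt_0_iff)
  ultimately show ?thesis by (simp add: card_cartesian_product)
qed

lemma card_C: "card C = card A"
proof -
  have "A \<inter> Z = Z" by (auto simp: Z_def)
  moreover have "card ((\<lambda>(a, z). \<delta> a \<otimes> z) ` (A \<times> (A \<inter> Z))) = card A"
    by (rule card_replacement[OF A order_refl]) (use in_Z_iff in blast)
  ultimately show ?thesis by (simp add: C_def)
qed

text \<open>
  \<open>a\<^bsup>-1\<^esup>\<close> and \<open>\<phi> a\<close> lie in the class two group generated by \<open>A\<close> and \<open>\<phi> A\<close>, and both have \<open>e\<close>-th power \<open>1\<close>.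
\<close>

lemma C_pow_eq_one:
  assumes e: "odd (e::nat)" and a: "a \<in> A" "a [^] e = \<one>" and z: "z \<in> Z" "z [^] e = \<one>"
  shows "(\<delta> a \<otimes> z) [^] e = \<one>"
proof -
  have G: "a \<in> carrier G" "\<phi> a \<in> carrier G" "z \<in> carrier G" "\<delta> a \<in> carrier G"
    using a z A_carrier \<phi>_carrier Z_carrier \<delta>_carrier by auto
  have ia: "inv a \<in> A" using a A_closed by blast
  obtain u where u: "u \<in> Z" "inv a \<otimes> \<phi> a = \<phi> a \<otimes> inv a \<otimes> u"
    using commutator_in_Z[OF ia, of "\<phi> a"] a by blast
  have uG: "u \<in> carrier G" by (rule Z_carrier[OF u(1)])
  have iu: "inv u \<in> Z" using Z_closed u by blast
  have "\<phi> a \<otimes> inv a \<otimes> u \<otimes> inv u = \<phi> a \<otimes> inv a" using G uG by (simp add: m_assoc)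
  then have "\<phi> a \<otimes> inv a = inv a \<otimes> \<phi> a \<otimes> inv u" using u(2) by simp
  moreover have "\<phi> a [^] e = \<one>" using \<phi>_pow[of a e] a G \<phi>_one by simp
  moreover have "inv a [^] e = \<one>" using a G by (simp add: nat_pow_inv)
  moreover have "inv u \<otimes> inv a = inv a \<otimes> inv u" "inv u \<otimes> \<phi> a = \<phi> a \<otimes> inv u"
    using Z_central[OF iu] ia a by blast+
  ultimately have "\<delta> a [^] e = \<one>" unfolding \<delta>_def
    using pow_mult_eq_one_if_class_two[OF e, of "inv a" "\<phi> a" "inv u"] G uG by simp
  then show ?thesis using pow_mult_distrib[of "\<delta> a" z e] Z_\<delta>[OF z(1) a(1)] G z by simp
qed

lemma card_torsion_le:
  assumes e: "odd (e::nat)"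
  shows "card {x \<in> A. x [^] e = \<one>} \<le> card {x \<in> C. x [^] e = \<one>}"
proof -
  let ?P = "{x \<in> A. x [^] e = \<one>}"
  let ?f = "\<lambda>(a, z). \<delta> a \<otimes> z"
  have P: "subgroup ?P G"
  proof (rule subgroup_of_finite_if_closed[OF fin])
    fix x y assume "x \<in> ?P" "y \<in> ?P"
    then show "x \<otimes> y \<in> ?P"
      using pow_mult_distrib[of x y e] A_comm A_carrier A_closed by auto
  qed (use A_carrier A_closed in auto)
  have "\<phi> k \<in> ?P" if "k \<in> ?P \<inter> Z" for k
    using that in_Z_iff \<phi>_pow[of k e] A_carrier \<phi>_one by auto
  then have "card (?f ` (?P \<times> (?P \<inter> Z))) = card ?P"
    by (intro card_replacement[OF P]) auto
  then have "card ?P = card (?f ` (?P \<times> (?P \<inter> Z)))" by (rule sym)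
  also have "\<dots> \<le> card {x \<in> C. x [^] e = \<one>}"
  proof (rule card_mono)
    show "?f ` (?P \<times> (?P \<inter> Z)) \<subseteq> {x \<in> C. x [^] e = \<one>}"
    using CI C_pow_eq_one[OF e] by auto
    show "finite {x \<in> C. x [^] e = \<one>}"
      using finite_subset[OF subgroup.subset[OF C] fin] by simp
  qed
  finally show ?thesis .
qed

lemma C_le_normalizer: "C \<subseteq> normalizer G A"
proof -
  have AG: "A \<subseteq> carrier G" using A_carrier by blast
  note mem = mem_normalizer_of_finite_iff[OF finite_A AG]
  have N: "subgroup (normalizer G A) G" by (rule normalizer_imp_subgroup[OF AG])
  have "A \<subseteq> normalizer G A" using mem AG A_closed by auto
  moreover have "\<phi> ` A \<subseteq> normalizer G A"
    using mem conjugate_normalizes A_carrier \<phi>_carrier by (auto simp: \<phi>_def)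
  ultimately have "inv a \<otimes> \<phi> a \<otimes> z \<in> normalizer G A" if "a \<in> A" "z \<in> Z" for a z
    using that by (intro subgroup.m_closed[OF N] subgroup.m_inv_closed[OF N]) (auto simp: Z_def)
  then show ?thesis by (auto simp: C_def \<delta>_def)
qed

lemma C_le_normal_closure: "C \<subseteq> normal_closure G A"
proof -
  have N: "subgroup (normal_closure G A) G" unfolding normal_closure_def
    by (rule generate_is_subgroup) (use A_carrier in auto)
  have conj: "inv g \<otimes> a \<otimes> g \<in> normal_closure G A" if "g \<in> carrier G" "a \<in> A" for g a
    unfolding normal_closure_def using that by (intro generate.incl) blast
  have "a \<in> normal_closure G A" if "a \<in> A" for a
    using conj[OF one_closed that] A_carrier[OF that] by simp
  moreover have "\<phi> a \<in> normal_closure G A" if "a \<in> A" for a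
    using conj[of "inv b" a] that b_carrier by (simp add: \<phi>_def)
  ultimately show ?thesis
    using subgroup.m_closed[OF N] subgroup.m_inv_closed[OF N]
    by (auto elim!: CE simp: \<delta>_def Z_def)
qed

lemma Int_psubset:
  assumes "b \<notin> normalizer G A"
  shows "A \<inter> B \<subset> C \<inter> B"
proof -
  have "A \<subseteq> carrier G" using A_carrier by blast
  then obtain a where a: "a \<in> A" "\<phi> a \<notin> A"
    using assms b_carrier by (auto simp: mem_normalizer_of_finite_iff[OF finite_A] \<phi>_def)
  have G: "a \<in> carrier G" "\<phi> a \<in> carrier G" using a A_carrier \<phi>_carrier by auto
  have "\<delta> a \<in> C" using CI[OF a(1) Z_closed(3)] \<delta>_carrier[OF a(1)] by simp
  moreover have "a \<otimes> \<delta> a = \<phi> a" using G by (simp add: \<delta>_def cancel_inv_left)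
  then have "\<delta> a \<notin> A" using a A_closed(1)[of a "\<delta> a"] by auto
  ultimately have "\<delta> a \<in> C \<inter> B - A" using \<delta>_in_B a by blast
  moreover have "A \<inter> B \<subseteq> C \<inter> B" using Int_sub_Z Z_sub_C by blast
  ultimately show ?thesis by blast
qed

end

section \<open>Choice of the conjugating element\<close>

text \<open>
  Take \<open>M\<close> to be the normalizer of \<open>A\<close> in \<open>A B\<close>. It is proper, so some \<open>k = a b\<close> outside \<open>M\<close>
  normalizes it, and the factor \<open>a \<in> M\<close> can be dropped. Then \<open>A\<close> and its conjugate by \<open>b\<close> normalize
  each other, because the conjugates of \<open>A\<close> by \<open>b\<close> and by \<open>b\<^bsup>-1\<^esup>\<close> both lie in \<open>M\<close>.
\<close>

lemma (in group) exists_normalizing_element: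
  assumes p: "Factorial_Ring.prime p" and ord: "order G = p ^ n"
    and A: "subgroup A G" and B: "subgroup B G"
    and A_normalizes_B: "\<And>a x. a \<in> A \<Longrightarrow> x \<in> B \<Longrightarrow> a \<otimes> x \<otimes> inv a \<in> B"
    and notin: "\<not> B \<subseteq> normalizer G A"
  shows "\<exists>b \<in> B - normalizer G A. \<exists>M. subgroup M G \<and> A \<subseteq> M \<and> M \<subseteq> normalizer G A \<and>
    b \<in> normalizer G M"
proof -
  have fin: "finite (carrier G)" by (rule finite_carrier_if_order_prime_power[OF p ord])
  have AG: "A \<subseteq> carrier G" and BG: "B \<subseteq> carrier G" using A B subgroup.subset by blast+
  have finA: "finite A" by (rule finite_subset[OF AG fin])
  define K where "K = A <#> B"
  have KI: "a \<otimes> x \<in> K" if "a \<in> A" "x \<in> B" for a x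
    using that by (auto simp: K_def set_mult_def)
  have KE: "\<exists>a \<in> A. \<exists>x \<in> B. k = a \<otimes> x" if "k \<in> K" for k
    using that by (auto simp: K_def set_mult_def)
  have oneA: "\<one> \<in> A" and oneB: "\<one> \<in> B" using A B subgroup.one_closed by blast+
  have K: "subgroup K G"
  proof (rule subgroup_of_finite_if_closed[OF fin])
    show "K \<subseteq> carrier G" using KE AG BG by blast
    show "\<one> \<in> K" using KI[OF oneA oneB] by simp
  next
    fix u v assume "u \<in> K" "v \<in> K"
    then obtain a x c y where *: "a \<in> A" "x \<in> B" "c \<in> A" "y \<in> B" and uv: "u = a \<otimes> x" "v = c \<otimes> y"
      using KE by metis
    have G: "a \<in> carrier G" "x \<in> carrier G" "c \<in> carrier G" "y \<in> carrier G" using * AG BG by auto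
    have ic: "inv c \<in> A" by (rule subgroup.m_inv_closed[OF A *(3)])
    have "inv c \<otimes> x \<otimes> inv (inv c) \<in> B" by (rule A_normalizes_B[OF ic *(2)])
    then have "(a \<otimes> c) \<otimes> ((inv c \<otimes> x \<otimes> inv (inv c)) \<otimes> y) \<in> K"
      by (rule KI[OF subgroup.m_closed[OF A *(1,3)] subgroup.m_closed[OF B _ *(4)]])
    moreover have "u \<otimes> v = (a \<otimes> c) \<otimes> ((inv c \<otimes> x \<otimes> inv (inv c)) \<otimes> y)"
      using G uv by (simp add: m_assoc cancel_inv_left)
    ultimately show "u \<otimes> v \<in> K" by simp
  qed
  have N: "subgroup (normalizer G A) G" by (rule normalizer_imp_subgroup[OF AG])
  define M where "M = normalizer G A \<inter> K"
  have M: "subgroup M G" unfolding M_def by (rule subgroups_Inter_pair[OF N K])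
  have AK: "A \<subseteq> K" using KI[OF _ oneB] AG by force
  have BK: "B \<subseteq> K" using KI[OF oneA] BG by force
  have "A \<subseteq> normalizer G A"
    by (rule subgroup_le_normalizer[OF finA A])
  then have AM: "A \<subseteq> M" using AK by (simp add: M_def)
  have "M \<subset> K" using notin BK by (auto simp: M_def)
  then obtain k where k: "k \<in> K" "k \<notin> M" "\<And>m. m \<in> M \<Longrightarrow> k \<otimes> m \<otimes> inv k \<in> M"
    using normalizers_grow[OF p ord M K] by blast
  have MG: "M \<subseteq> carrier G" by (rule subgroup.subset[OF M])
  have finM: "finite M" by (rule finite_subset[OF MG fin])
  have NM: "subgroup (normalizer G M) G" by (rule normalizer_imp_subgroup[OF MG])
  obtain a b where ab: "a \<in> A" "b \<in> B" "k = a \<otimes> b" using KE[OF k(1)] by blast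
  have "k \<in> normalizer G M"
    using mem_normalizer_of_finite_iff[OF finM MG] k subgroup.mem_carrier[OF K] by blast
  moreover have "a \<in> normalizer G M" using subgroup_le_normalizer[OF finM M] AM ab by blast
  ultimately have "inv a \<otimes> k \<in> normalizer G M"
    by (intro subgroup.m_closed[OF NM] subgroup.m_inv_closed[OF NM])
  moreover have "inv a \<otimes> k = b"
    unfolding ab(3) by (rule cancel_inv_left(1)) (use ab AG BG in auto)
  ultimately have "b \<in> normalizer G M" by simp
  moreover have "b \<notin> normalizer G A"
  proof
    assume "b \<in> normalizer G A"
    then have "b \<in> M" using ab BK by (auto simp: M_def)
    then have "k \<in> M" using ab AM subgroup.m_closed[OF M] by blast
    then show False using k by blast
  qed
  ultimately show ?thesis using ab(2) M AM by (auto simp: M_def)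
qed

theorem theorem1:
  fixes p :: nat and G :: "('a, 'b) monoid_scheme" and A B :: "'a set"
  assumes "Factorial_Ring.prime p" and "odd p"
    and "finite_p_group p G"
    and "subgroup A G" and "comm_group (G\<lparr>carrier := A\<rparr>)"
    and "subgroup B G"
    and "nilpotent_of_class_at_most G B 2"
    and "derived G B \<subseteq> A"
    and "A \<subseteq> normalizer G B"
    and "\<not> B \<subseteq> normalizer G A"
  shows "\<exists>A'. subgroup A' G \<and> comm_group (G\<lparr>carrier := A'\<rparr>) \<and>
           card A = card A' \<and>
           A \<inter> B \<subset> A' \<inter> B \<and>
           A' \<subseteq> normalizer G A \<inter> normal_closure G A \<and>
           subgroup_exponent G A' dvd subgroup_exponent G A \<and>
           subgroup_rank G A \<le> subgroup_rank G A'"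
proof -
  interpret group G using assms(3) by (simp add: finite_p_group_def)
  obtain n where fin: "finite (carrier G)" and ord: "order G = p ^ n"
    using assms(3) by (auto simp: finite_p_group_def)
  note A = assms(4) and B = assms(6)
  have AG: "A \<subseteq> carrier G" and BG: "B \<subseteq> carrier G" using A B subgroup.subset by blast+
  have finA: "finite A" and finB: "finite B" using AG BG fin finite_subset by auto
  have odd_order: "odd (order G)" using ord assms(2) by simp
  note memB = mem_normalizer_of_finite_iff[OF finB BG]
  have A_normalizes_B: "a \<otimes>\<^bsub>G\<^esub> x \<otimes>\<^bsub>G\<^esub> inv\<^bsub>G\<^esub> a \<in> B" if "a \<in> A" "x \<in> B" for a x
    using subsetD[OF assms(9) that(1)] that(2) memB by blast
  obtain b M where b_in: "b \<in> B" and b_notin: "b \<notin> normalizer G A" and M: "subgroup M G" "A \<subseteq> M" "M \<subseteq> normalizer G A"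
    and bM: "b \<in> normalizer G M"
    using exists_normalizing_element[OF assms(1) ord A B A_normalizes_B assms(10)] by blast
  have bG: "b \<in> carrier G" using b_in BG by blast
  have MG: "M \<subseteq> carrier G" by (rule subgroup.subset[OF M(1)])
  note memM = mem_normalizer_of_finite_iff[OF finite_subset[OF MG fin] MG]
  have ibM: "inv\<^bsub>G\<^esub> b \<in> normalizer G M"
    by (rule subgroup.m_inv_closed[OF normalizer_imp_subgroup[OF MG] bM])
  have M_normalizes_A: "m \<otimes>\<^bsub>G\<^esub> a \<otimes>\<^bsub>G\<^esub> inv\<^bsub>G\<^esub> m \<in> A" if "m \<in> M" "a \<in> A" for m a
    using subsetD[OF M(3) that(1)] that(2) mem_normalizer_of_finite_iff[OF finA AG] by blast
  interpret replacement G A B b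
  proof (intro replacement.intro[OF is_group] replacement_axioms.intro)
    show "finite (carrier G)" "odd (order G)" "subgroup A G" "subgroup B G" "b \<in> B" by fact+
    fix x y assume "x \<in> A" "y \<in> A"
    then show "x \<otimes>\<^bsub>G\<^esub> y = y \<otimes>\<^bsub>G\<^esub> x"
      using comm_groupE(4)[OF assms(5)] by simp
  next
    fix x y assume "x \<in> B" "y \<in> B"
    then show "x \<otimes>\<^bsub>G\<^esub> y \<otimes>\<^bsub>G\<^esub> inv\<^bsub>G\<^esub> x \<otimes>\<^bsub>G\<^esub> inv\<^bsub>G\<^esub> y \<in> A"
      using assms(8) unfolding derived_def by (blast intro: generate.incl)
  next
    fix a x assume "a \<in> A" "x \<in> B"
    then show "a \<otimes>\<^bsub>G\<^esub> x \<otimes>\<^bsub>G\<^esub> inv\<^bsub>G\<^esub> a \<in> B" by (rule A_normalizes_B)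
  next
    fix a c assume "a \<in> A" "c \<in> A"
    moreover from this have "b \<otimes>\<^bsub>G\<^esub> c \<otimes>\<^bsub>G\<^esub> inv\<^bsub>G\<^esub> b \<in> M" using bM memM M by blast
    ultimately show "b \<otimes>\<^bsub>G\<^esub> c \<otimes>\<^bsub>G\<^esub> inv\<^bsub>G\<^esub> b \<otimes>\<^bsub>G\<^esub> a \<otimes>\<^bsub>G\<^esub> inv\<^bsub>G\<^esub> (b \<otimes>\<^bsub>G\<^esub> c \<otimes>\<^bsub>G\<^esub> inv\<^bsub>G\<^esub> b) \<in> A"
      by (intro M_normalizes_A)
  next
    fix a c assume ac: "a \<in> A" "c \<in> A"
    \<comment> \<open>\<open>c\<close> normalizes the conjugate of \<open>A\<close> by \<open>b\<close> as \<open>b\<^bsup>-1\<^esup> c b\<close> normalizes \<open>A\<close>.\<close>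
    let ?d = "inv\<^bsub>G\<^esub> b \<otimes>\<^bsub>G\<^esub> c \<otimes>\<^bsub>G\<^esub> inv\<^bsub>G\<^esub> (inv\<^bsub>G\<^esub> b)"
    have "?d \<in> M" using ibM memM M ac by blast
    then have "?d \<otimes>\<^bsub>G\<^esub> a \<otimes>\<^bsub>G\<^esub> inv\<^bsub>G\<^esub> ?d \<in> A" using ac by (intro M_normalizes_A)
    moreover have "c \<otimes>\<^bsub>G\<^esub> (b \<otimes>\<^bsub>G\<^esub> a \<otimes>\<^bsub>G\<^esub> inv\<^bsub>G\<^esub> b) \<otimes>\<^bsub>G\<^esub> inv\<^bsub>G\<^esub> c =
        b \<otimes>\<^bsub>G\<^esub> (?d \<otimes>\<^bsub>G\<^esub> a \<otimes>\<^bsub>G\<^esub> inv\<^bsub>G\<^esub> ?d) \<otimes>\<^bsub>G\<^esub> inv\<^bsub>G\<^esub> b"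
      using ac AG bG by (auto simp: m_assoc inv_mult_group cancel_inv_left subset_iff)
    ultimately show "c \<otimes>\<^bsub>G\<^esub> (b \<otimes>\<^bsub>G\<^esub> a \<otimes>\<^bsub>G\<^esub> inv\<^bsub>G\<^esub> b) \<otimes>\<^bsub>G\<^esub> inv\<^bsub>G\<^esub> c \<in> (\<lambda>x. b \<otimes>\<^bsub>G\<^esub> x \<otimes>\<^bsub>G\<^esub> inv\<^bsub>G\<^esub> b) ` A"
      by blast
  qed
  \<comment> \<open>The subgroup \<open>C\<close> of the locale is the required replacement.\<close>
  have C_comm_group: "comm_group (G\<lparr>carrier := C\<rparr>)"
    by (rule group.group_comm_groupI[OF subgroup_imp_group[OF C]]) (simp add: C_comm)
  let ?e = "subgroup_exponent G A"
  have e: "x [^]\<^bsub>G\<^esub> ?e = \<one>\<^bsub>G\<^esub>" if "x \<in> A" for x by (rule pow_subgroup_exponent[OF fin A that])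
  have "?e dvd card A"
    by (rule subgroup_exponent_dvd[OF fin A subgroup_pow_card_eq_one[OF A]])
  also have "card A dvd order G" using lagrange[OF A] by (metis dvd_triv_right)
  finally have "odd ?e" using odd_order dvd_trans[of 2 ?e "order G"] by blast
  then have "x [^]\<^bsub>G\<^esub> ?e = \<one>\<^bsub>G\<^esub>" if "x \<in> C" for x
    using that e C_pow_eq_one by (auto simp: Z_def elim!: CE)
  then have exponent: "subgroup_exponent G C dvd ?e" by (rule subgroup_exponent_dvd[OF fin C])
  have "subgroup_rank G A \<le> subgroup_rank G C"
    by (rule rank_le_rank_if_card_le[OF assms(1) ord A assms(5) C C_comm_group card_torsion_le[OF assms(2)]])
  then show ?thesis
    using C C_comm_group card_C Int_psubset[OF b_notin] C_le_normalizer C_le_normal_closure exponent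
    by (intro exI[of _ C]) simp
qed

end
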